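(* Let $(X,E,\Phi)$ be an augmented tree of a compact space of homogeneous type $(K,\rho,\mu)$, and let $r_0\in(0,1)$ be the contraction ratio of $\Phi$. Then the graph $(X,E)$ is Gromov hyperbolic, and for $a>0$ the space $(K,\rho)$ is H\"older equivalent to the hyperbolic boundary $(\partial_H X,\varrho_a)$ in the following sense: with $\hat\kappa:\partial_HX\to K$ the canonical homeomorphism defined in the context, there is a constant $C\ge 1$ such that $$C^{-1}\rho(\hat\kappa(\xi),\hat\kappa(\eta))^{-a/\log r_0}\le \varrho_a(\xi,\eta)\le C\,\rho(\hat\kappa(\xi),\hat\kappa(\eta))^{-a/\log r_0}\qquad\text{for all }\xi,\eta\in\partial_HX.$$
   Context: **Spaces.** A quasi-metric $\rho$ on a set $K$ satisfies the axioms of a metric except that the triangle inequality is weakened to $\rho(\xi,\eta)\le C_\rho(\rho(\xi,\zeta)+\rho(\zeta,\eta))$ for some $C_\rho\ge1$. Put $B(\xi,r)=\{\eta:\rho(\xi,\eta)<r\}$; a set $\Omega$ is open if each $\xi\in\Omega$ has some $B(\xi,\varepsilon)\subset\Omega$, $\varepsilon>0$. A compact space of homogeneous type $(K,\rho,\mu)$ is a set $K$ with a quasi-metric $\rho$ for which $K$ is compact and all balls are open, and a non-negative regular Borel measure $\mu$ that is doubling: for some $C>0$, $0<\mu(B(\xi,2r))\le C\mu(B(\xi,r))<\infty$ for all $\xi\in K$, $r>0$. Standing normalization: $\sup_{\xi,\eta\in K}\rho(\xi,\eta)=1$ and $\mu(K)=1$. **Rooted graphs.** For a countably infinite connected graph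 $(X,E)$ with root $\vartheta$ and graph distance $d$, put $|x|=d(\vartheta,x)$, $\mathcal J_n=\{x:|x|=n\}$; $y\prec x$ means that $x$ lies on some geodesic from $\vartheta$ to $y$; $\mathcal J_m(x)=\{y\prec x:|y|=|x|+m\}$. A rooted tree is such a graph where all edges join consecutive levels and each $x\ne\vartheta$ has a unique parent $x^-$ (so $x\in\mathcal J_1(x^-)$). **Index tree.** $(X,E_v,\Phi)$ is an index tree of $(K,\rho,\mu)$ if $(X,E_v)$ is a rooted tree and $\Phi$ maps $X$ to nonempty compact subsets of $K$ with: (i) $\Phi(\vartheta)=K$ and $\Phi(x)=\bigcup_{y\in\mathcal J_1(x)}\Phi(y)$ for all $x$; (ii) there are $b,c>0$ and $r_0\in(0,1)$ (the contraction ratio) such that each $x\in X$ admits $\xi_x\in K$ with $B(\xi_x,br_0^{|x|})\subset\Phi(x)\subset B(\xi_x,cr_0^{|x|})$; (iii) $\mu(\Phi(x)\cap\Phi(y))=0$ for distinct $x,y$ with $|x|=|y|$. **Augmented tree.** For a fixed $\gamma>0$, let $E_h=\bigcup_{m\ge1}\{(x,y)\in\mathcal J_m\times\mathcal J_m:x\ne y,\ \mathrm{dist}(\Phi(x),\Phi(y))\le\gamma r_0^m\}$ (distance with respect to $\rho$), and $E=E_v\cup E_h$. Then $(X,E,\Phi)$ is called an augmented tree of $(K,\rho,\mu)$. **Hyperbolicity.** The Gromov product is $(x|y)=\frac12(|x|+|y|-d(x,y))$. $(X,E)$ is (Gromov) hyperbolic if for some $\delta\ge0$, $(x|y)\ge\min\{(x|z),(z|y)\}-\delta$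 for all $x,y,z\in X$. For $a>0$ let $\varrho_a(x,y)=e^{-a(x|y)}$ for $x\ne y$ and $\varrho_a(x,x)=0$. $\widehat X_H$ is the $\varrho_a$-completion of $X$ (topology independent of $a$) and $\partial_HX=\widehat X_H\setminus X$ is the hyperbolic boundary. Each $\xi\in\partial_HX$ is the limit of geodesic rays $[\vartheta,x_1,x_2,\dots]$ from $\vartheta$. The Gromov product is extended by $(x|\eta)=\sup\lim_n(x|y_n)$ and $(\xi|\eta)=\sup\lim_n(x_n|y_n)$ for $x\in X$, $\xi,\eta\in\partial_HX$, the suprema being over all geodesic rays $[\vartheta,x_1,\dots]$ converging to $\xi$ and $[\vartheta,y_1,\dots]$ converging to $\eta$. Then $\varrho_a$ is extended to $\widehat X_H$ by the same formula ($e^{-a(\xi|\eta)}$ for $\xi\ne\eta$, and $0$ for $\xi=\eta$). **The map $\hat\kappa$.** For $\xi\in\partial_HX$, $\hat\kappa(\xi)$ is the unique point of $\bigcap_{n\ge0}\Phi(x_n)$, where $[x_0=\vartheta,x_1,\dots]$ is any geodesic ray from $\vartheta$ converging to $\xi$ (independent of the choice of the ray). $\hat\kappa$ is a homeomorphism $\partial_HX\to K$. *)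

theory Defs
  imports "HOL-Analysis.Analysis"
begin

section \<open>Spaces of homogeneous type\<close>

definition quasi_metric_on :: "'k set \<Rightarrow> ('k \<Rightarrow> 'k \<Rightarrow> real) \<Rightarrow> bool" where
  "quasi_metric_on K \<rho> \<longleftrightarrow>
     (\<forall>\<xi>\<in>K. \<forall>\<eta>\<in>K. 0 \<le> \<rho> \<xi> \<eta> \<and> (\<rho> \<xi> \<eta> = 0 \<longleftrightarrow> \<xi> = \<eta>) \<and> \<rho> \<xi> \<eta> = \<rho> \<eta> \<xi>) \<and>
     (\<exists>C\<ge>1. \<forall>\<xi>\<in>K. \<forall>\<eta>\<in>K. \<forall>\<zeta>\<in>K. \<rho> \<xi> \<eta> \<le> C * (\<rho> \<xi> \<zeta> + \<rho> \<zeta> \<eta>))"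

definition qball :: "'k set \<Rightarrow> ('k \<Rightarrow> 'k \<Rightarrow> real) \<Rightarrow> 'k \<Rightarrow> real \<Rightarrow> 'k set" where
  "qball K \<rho> \<xi> r = {\<eta>\<in>K. \<rho> \<xi> \<eta> < r}"

definition qtopology :: "'k set \<Rightarrow> ('k \<Rightarrow> 'k \<Rightarrow> real) \<Rightarrow> 'k topology" where
  "qtopology K \<rho> = topology (\<lambda>\<Omega>. \<Omega> \<subseteq> K \<and> (\<forall>\<xi>\<in>\<Omega>. \<exists>\<epsilon>>0. qball K \<rho> \<xi> \<epsilon> \<subseteq> \<Omega>))"

lemma openin_qtopology:
  "openin (qtopology K \<rho>) \<Omega> \<longleftrightarrow> \<Omega> \<subseteq> K \<and> (\<forall>\<xi>\<in>\<Omega>. \<exists>\<epsilon>>0. qball K \<rho> \<xi> \<epsilon> \<subseteq> \<Omega>)"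
proof -
  have "istopology (\<lambda>\<Omega>. \<Omega> \<subseteq> K \<and> (\<forall>\<xi>\<in>\<Omega>. \<exists>\<epsilon>>0. qball K \<rho> \<xi> \<epsilon> \<subseteq> \<Omega>))"
    unfolding istopology_def
  proof (intro conjI allI impI ballI)
    fix S T \<xi>
    assume S: "S \<subseteq> K \<and> (\<forall>\<xi>\<in>S. \<exists>\<epsilon>>0. qball K \<rho> \<xi> \<epsilon> \<subseteq> S)"
      and T: "T \<subseteq> K \<and> (\<forall>\<xi>\<in>T. \<exists>\<epsilon>>0. qball K \<rho> \<xi> \<epsilon> \<subseteq> T)" and x: "\<xi> \<in> S \<inter> T"
    obtain d e where "d > 0" "qball K \<rho> \<xi> d \<subseteq> S" "e > 0" "qball K \<rho> \<xi> e \<subseteq> T"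
      using S T x by blast
    then show "\<exists>\<epsilon>>0. qball K \<rho> \<xi> \<epsilon> \<subseteq> S \<inter> T"
      by (intro exI[of _ "min d e"]) (auto simp: qball_def)
  next
    fix \<K> \<xi>
    assume *: "\<forall>S\<in>\<K>. S \<subseteq> K \<and> (\<forall>\<xi>\<in>S. \<exists>\<epsilon>>0. qball K \<rho> \<xi> \<epsilon> \<subseteq> S)" and "\<xi> \<in> \<Union>\<K>"
    then obtain S where "S \<in> \<K>" "\<xi> \<in> S" by blast
    with * show "\<exists>\<epsilon>>0. qball K \<rho> \<xi> \<epsilon> \<subseteq> \<Union>\<K>" by (meson Union_upper order_trans)
  qed blast+
  then show ?thesis by (simp add: qtopology_def topology_inverse')
qed

lemma topspace_qtopology [simp]: "topspace (qtopology K \<rho>) = K"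
proof
  show "topspace (qtopology K \<rho>) \<subseteq> K"
    using openin_topspace[of "qtopology K \<rho>"] unfolding openin_qtopology by blast
  have "openin (qtopology K \<rho>) K"
    unfolding openin_qtopology qball_def by (auto intro: exI[of _ "1::real"])
  then show "K \<subseteq> topspace (qtopology K \<rho>)" by (rule openin_subset)
qed

definition regular_borel_measure_on :: "'k topology \<Rightarrow> 'k measure \<Rightarrow> bool" where
  "regular_borel_measure_on T \<mu> \<longleftrightarrow>
     space \<mu> = topspace T \<and>
     sets \<mu> = sigma_sets (topspace T) {U. openin T U} \<and>
     (\<forall>A\<in>sets \<mu>.
        emeasure \<mu> A = (INF U\<in>{U. openin T U \<and> A \<subseteq> U}. emeasure \<mu> U) \<and>
        emeasure \<mu> A = (SUP C\<in>{C. compactin T C \<and> C \<subseteq> A}. emeasure \<mu> C))"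

text \<open>The last two conjuncts are the normalization of diameter and total mass.\<close>

definition compact_homogeneous_space ::
    "'k set \<Rightarrow> ('k \<Rightarrow> 'k \<Rightarrow> real) \<Rightarrow> 'k measure \<Rightarrow> bool" where
  "compact_homogeneous_space K \<rho> \<mu> \<longleftrightarrow>
     quasi_metric_on K \<rho> \<and>
     compact_space (qtopology K \<rho>) \<and>
     (\<forall>\<xi>\<in>K. \<forall>r. openin (qtopology K \<rho>) (qball K \<rho> \<xi> r)) \<and>
     regular_borel_measure_on (qtopology K \<rho>) \<mu> \<and>
     (\<exists>C>0. \<forall>\<xi>\<in>K. \<forall>r>0.
        0 < emeasure \<mu> (qball K \<rho> \<xi> (2 * r)) \<and>
        emeasure \<mu> (qball K \<rho> \<xi> (2 * r)) \<le> ennreal C * emeasure \<mu> (qball K \<rho> \<xi> r) \<and>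
        ennreal C * emeasure \<mu> (qball K \<rho> \<xi> r) < \<infinity>) \<and>
     bdd_above {\<rho> \<xi> \<eta> |\<xi> \<eta>. \<xi> \<in> K \<and> \<eta> \<in> K} \<and>
     Sup {\<rho> \<xi> \<eta> |\<xi> \<eta>. \<xi> \<in> K \<and> \<eta> \<in> K} = 1 \<and>
     emeasure \<mu> K = 1"


section \<open>Rooted graphs and trees\<close>

text \<open>A graph is a vertex set \<open>X\<close> with a symmetric irreflexive edge relation \<open>E\<close>; a walk of
  length \<open>n\<close> from \<open>x\<close> to \<open>y\<close> exists iff \<open>(x, y) \<in> E ^^ n\<close>.\<close>

definition gdist :: "'x rel \<Rightarrow> 'x \<Rightarrow> 'x \<Rightarrow> nat" where
  "gdist E x y = (LEAST n. (x, y) \<in> E ^^ n)"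

definition rooted_graph :: "'x set \<Rightarrow> 'x rel \<Rightarrow> 'x \<Rightarrow> bool" where
  "rooted_graph X E \<theta> \<longleftrightarrow>
     countable X \<and> infinite X \<and> \<theta> \<in> X \<and>
     E \<subseteq> X \<times> X \<and> sym E \<and> irrefl E \<and>
     (\<forall>x\<in>X. \<forall>y\<in>X. (x, y) \<in> E\<^sup>*)"

abbreviation height :: "'x rel \<Rightarrow> 'x \<Rightarrow> 'x \<Rightarrow> nat" where
  "height E \<theta> x \<equiv> gdist E \<theta> x"

definition level :: "'x set \<Rightarrow> 'x rel \<Rightarrow> 'x \<Rightarrow> nat \<Rightarrow> 'x set" where
  "level X E \<theta> n = {x\<in>X. height E \<theta> x = n}"

definition geodesic :: "'x rel \<Rightarrow> 'x \<Rightarrow> 'x \<Rightarrow> 'x list \<Rightarrow> bool" where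
  "geodesic E x y p \<longleftrightarrow>
     p \<noteq> [] \<and> hd p = x \<and> last p = y \<and>
     successively (\<lambda>u v. (u, v) \<in> E) p \<and> length p = Suc (gdist E x y)"

text \<open>\<open>descendant E \<theta> y x\<close> is \<open>y \<prec> x\<close>; it is reflexive.\<close>

definition descendant :: "'x rel \<Rightarrow> 'x \<Rightarrow> 'x \<Rightarrow> 'x \<Rightarrow> bool" where
  "descendant E \<theta> y x \<longleftrightarrow> (\<exists>p. geodesic E \<theta> y p \<and> x \<in> set p)"

definition descendants_at :: "'x set \<Rightarrow> 'x rel \<Rightarrow> 'x \<Rightarrow> nat \<Rightarrow> 'x \<Rightarrow> 'x set" where
  "descendants_at X E \<theta> m x =
     {y\<in>X. descendant E \<theta> y x \<and> height E \<theta> y = height E \<theta> x + m}"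

definition rooted_tree :: "'x set \<Rightarrow> 'x rel \<Rightarrow> 'x \<Rightarrow> bool" where
  "rooted_tree X E \<theta> \<longleftrightarrow>
     rooted_graph X E \<theta> \<and>
     (\<forall>(x, y)\<in>E. height E \<theta> y = Suc (height E \<theta> x) \<or> height E \<theta> x = Suc (height E \<theta> y)) \<and>
     (\<forall>x\<in>X - {\<theta>}. \<exists>!z. z \<in> X \<and> x \<in> descendants_at X E \<theta> 1 z)"


section \<open>Index trees and augmented trees\<close>

definition index_tree ::
    "'k set \<Rightarrow> ('k \<Rightarrow> 'k \<Rightarrow> real) \<Rightarrow> 'k measure \<Rightarrow>
     'x set \<Rightarrow> 'x rel \<Rightarrow> 'x \<Rightarrow> ('x \<Rightarrow> 'k set) \<Rightarrow> real \<Rightarrow> bool" where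
  "index_tree K \<rho> \<mu> X E\<^sub>v \<theta> \<Phi> r\<^sub>0 \<longleftrightarrow>
     rooted_tree X E\<^sub>v \<theta> \<and>
     (\<forall>x\<in>X. \<Phi> x \<noteq> {} \<and> compactin (qtopology K \<rho>) (\<Phi> x)) \<and>
     \<Phi> \<theta> = K \<and>
     (\<forall>x\<in>X. \<Phi> x = (\<Union>y\<in>descendants_at X E\<^sub>v \<theta> 1 x. \<Phi> y)) \<and>
     0 < r\<^sub>0 \<and> r\<^sub>0 < 1 \<and>
     (\<exists>b>0. \<exists>c>0. \<forall>x\<in>X. \<exists>\<xi>\<in>K.
        qball K \<rho> \<xi> (b * r\<^sub>0 ^ height E\<^sub>v \<theta> x) \<subseteq> \<Phi> x \<and>
        \<Phi> x \<subseteq> qball K \<rho> \<xi> (c * r\<^sub>0 ^ height E\<^sub>v \<theta> x)) \<and>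
     (\<forall>x\<in>X. \<forall>y\<in>X. x \<noteq> y \<longrightarrow> height E\<^sub>v \<theta> x = height E\<^sub>v \<theta> y \<longrightarrow>
        emeasure \<mu> (\<Phi> x \<inter> \<Phi> y) = 0)"

definition set_dist :: "('k \<Rightarrow> 'k \<Rightarrow> real) \<Rightarrow> 'k set \<Rightarrow> 'k set \<Rightarrow> real" where
  "set_dist \<rho> A B = Inf {\<rho> \<xi> \<eta> |\<xi> \<eta>. \<xi> \<in> A \<and> \<eta> \<in> B}"

definition horizontal_edges ::
    "('k \<Rightarrow> 'k \<Rightarrow> real) \<Rightarrow> 'x set \<Rightarrow> 'x rel \<Rightarrow> 'x \<Rightarrow> ('x \<Rightarrow> 'k set) \<Rightarrow> real \<Rightarrow> real \<Rightarrow> 'x rel" where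
  "horizontal_edges \<rho> X E\<^sub>v \<theta> \<Phi> r\<^sub>0 \<gamma> =
     (\<Union>m\<in>{1..}. {(x, y) \<in> level X E\<^sub>v \<theta> m \<times> level X E\<^sub>v \<theta> m.
                    x \<noteq> y \<and> set_dist \<rho> (\<Phi> x) (\<Phi> y) \<le> \<gamma> * r\<^sub>0 ^ m})"

definition augmented_tree ::
    "'k set \<Rightarrow> ('k \<Rightarrow> 'k \<Rightarrow> real) \<Rightarrow> 'k measure \<Rightarrow>
     'x set \<Rightarrow> 'x rel \<Rightarrow> 'x rel \<Rightarrow> 'x \<Rightarrow> ('x \<Rightarrow> 'k set) \<Rightarrow> real \<Rightarrow> real \<Rightarrow> bool" where
  "augmented_tree K \<rho> \<mu> X E\<^sub>v E \<theta> \<Phi> r\<^sub>0 \<gamma> \<longleftrightarrow>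
     index_tree K \<rho> \<mu> X E\<^sub>v \<theta> \<Phi> r\<^sub>0 \<and> 0 < \<gamma> \<and>
     E = E\<^sub>v \<union> horizontal_edges \<rho> X E\<^sub>v \<theta> \<Phi> r\<^sub>0 \<gamma>"


section \<open>Hyperbolicity and the hyperbolic boundary\<close>

definition gromov_product :: "'x rel \<Rightarrow> 'x \<Rightarrow> 'x \<Rightarrow> 'x \<Rightarrow> real" where
  "gromov_product E \<theta> x y =
     (real (height E \<theta> x) + real (height E \<theta> y) - real (gdist E x y)) / 2"

definition gromov_hyperbolic :: "'x set \<Rightarrow> 'x rel \<Rightarrow> 'x \<Rightarrow> bool" where
  "gromov_hyperbolic X E \<theta> \<longleftrightarrow>
     (\<exists>\<delta>\<ge>0. \<forall>x\<in>X. \<forall>y\<in>X. \<forall>z\<in>X.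
        gromov_product E \<theta> x y \<ge> min (gromov_product E \<theta> x z) (gromov_product E \<theta> z y) - \<delta>)"

definition visual :: "'x rel \<Rightarrow> 'x \<Rightarrow> real \<Rightarrow> 'x \<Rightarrow> 'x \<Rightarrow> real" where
  "visual E \<theta> a x y = (if x = y then 0 else exp (- a * gromov_product E \<theta> x y))"

text \<open>Completion by equivalence classes of Cauchy sequences. This is done for an arbitrary
  distance function \<open>\<rho>\<close>, because the library's completion needs a genuine metric. The limit in the
  completion of a Cauchy sequence \<open>s\<close> is its class, so \<open>s\<close> converges to \<open>\<xi>\<close> iff \<open>s \<in> \<xi>\<close>; a
  point \<open>x\<close> is identified with the class of the constant sequence.\<close>

definition cauchy_seqs :: "'x set \<Rightarrow> ('x \<Rightarrow> 'x \<Rightarrow> real) \<Rightarrow> (nat \<Rightarrow> 'x) set" where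
  "cauchy_seqs X \<rho> =
     {s. range s \<subseteq> X \<and> (\<forall>\<epsilon>>0. \<exists>N. \<forall>m\<ge>N. \<forall>n\<ge>N. \<rho> (s m) (s n) < \<epsilon>)}"

definition cauchy_equiv :: "'x set \<Rightarrow> ('x \<Rightarrow> 'x \<Rightarrow> real) \<Rightarrow> (nat \<Rightarrow> 'x) rel" where
  "cauchy_equiv X \<rho> =
     {(s, t) \<in> cauchy_seqs X \<rho> \<times> cauchy_seqs X \<rho>. (\<lambda>n. \<rho> (s n) (t n)) \<longlonglongrightarrow> 0}"

definition completion :: "'x set \<Rightarrow> ('x \<Rightarrow> 'x \<Rightarrow> real) \<Rightarrow> (nat \<Rightarrow> 'x) set set" where
  "completion X \<rho> = cauchy_seqs X \<rho> // cauchy_equiv X \<rho>"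

definition completion_embed :: "'x set \<Rightarrow> ('x \<Rightarrow> 'x \<Rightarrow> real) \<Rightarrow> 'x \<Rightarrow> (nat \<Rightarrow> 'x) set" where
  "completion_embed X \<rho> x = cauchy_equiv X \<rho> `` {\<lambda>n. x}"

definition hyperbolic_boundary :: "'x set \<Rightarrow> 'x rel \<Rightarrow> 'x \<Rightarrow> real \<Rightarrow> (nat \<Rightarrow> 'x) set set" where
  "hyperbolic_boundary X E \<theta> a =
     completion X (visual E \<theta> a) - completion_embed X (visual E \<theta> a) ` X"

definition geodesic_ray :: "'x rel \<Rightarrow> 'x \<Rightarrow> (nat \<Rightarrow> 'x) \<Rightarrow> bool" where
  "geodesic_ray E \<theta> s \<longleftrightarrow>
     s 0 = \<theta> \<and> (\<forall>n. (s n, s (Suc n)) \<in> E) \<and> (\<forall>m k. gdist E (s m) (s (m + k)) = k)"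

definition rays_to :: "'x rel \<Rightarrow> 'x \<Rightarrow> (nat \<Rightarrow> 'x) set \<Rightarrow> (nat \<Rightarrow> 'x) set" where
  "rays_to E \<theta> \<xi> = {s. geodesic_ray E \<theta> s \<and> s \<in> \<xi>}"

text \<open>Along geodesic rays from the root the Gromov product is nondecreasing in \<open>n\<close>, so the limit
  exists in the extended reals.\<close>

definition boundary_product ::
    "'x rel \<Rightarrow> 'x \<Rightarrow> (nat \<Rightarrow> 'x) set \<Rightarrow> (nat \<Rightarrow> 'x) set \<Rightarrow> ereal" where
  "boundary_product E \<theta> \<xi> \<eta> =
     (SUP (s, t)\<in>rays_to E \<theta> \<xi> \<times> rays_to E \<theta> \<eta>.
        lim (\<lambda>n. ereal (gromov_product E \<theta> (s n) (t n))))"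

text \<open>For distinct boundary points of a hyperbolic graph the product below is finite, so
  \<^const>\<open>real_of_ereal\<close> loses nothing.\<close>

definition boundary_visual ::
    "'x rel \<Rightarrow> 'x \<Rightarrow> real \<Rightarrow> (nat \<Rightarrow> 'x) set \<Rightarrow> (nat \<Rightarrow> 'x) set \<Rightarrow> real" where
  "boundary_visual E \<theta> a \<xi> \<eta> =
     (if \<xi> = \<eta> then 0 else exp (- a * real_of_ereal (boundary_product E \<theta> \<xi> \<eta>)))"

definition kappa_hat :: "'x rel \<Rightarrow> 'x \<Rightarrow> ('x \<Rightarrow> 'k set) \<Rightarrow> (nat \<Rightarrow> 'x) set \<Rightarrow> 'k" where
  "kappa_hat E \<theta> \<Phi> \<xi> = (THE p. \<forall>s\<in>rays_to E \<theta> \<xi>. (\<Inter>n. \<Phi> (s n)) = {p})"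

end

theory Submission
  imports Defs
begin

text \<open>Let \<open>z x\<close> be the centre of \<open>\<Phi> x\<close> and put
  \<open>R x y = r\<^sub>0 ^ |x| + r\<^sub>0 ^ |y| + \<rho> (z x) (z y)\<close>. Then \<open>R x y\<close> is comparable to
  \<open>r\<^sub>0 powr (x|y)\<close>: climbing from \<open>x\<close> and \<open>y\<close> to the level \<open>m\<close> with \<open>r\<^sub>0 ^ m\<close> about \<open>R x y\<close> and
  crossing one horizontal edge bounds \<open>d(x, y)\<close> above, while along any geodesic the centres move by
  geometrically decaying amounts away from its middle, which bounds \<open>R x y\<close> above. The quasi-triangle
  inequality for \<open>R\<close> is the hyperbolicity of the graph. Moreover a sequence is Cauchy for
  \<open>\<rho>\<^sub>a\<close> iff it is eventually constant or it leaves every level and its centres converge in \<open>K\<close>, so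
  boundary points correspond to points of \<open>K\<close>; passing to the limit in the comparison gives the
  two-sided Hoelder bound, and with it the homeomorphism.\<close>

section \<open>Graph distance\<close>

text \<open>Powers of \<open>r\<^sub>0\<close> are the right scale because a base below 1 turns the
  minimum in the hyperbolicity inequality into a maximum and the additive \<delta> into a factor,
  which is exactly the loss that a quasi-triangle inequality causes. The first two summands of
  \<open>R\<close> are cell sizes: a vertex determines a position in \<open>K\<close> only up to the
  size of its cell, and with them the comparison holds for \<open>x = y\<close> as well. The
  obstacle is the constant of the quasi-triangle inequality. Along a chain of centres it enters with
  a power that grows with the length and may outrun the geometric decay of the steps; grouping the
  steps into blocks of fixed length keeps it under control. The boundary consists of abstract
  classes of sequences, so these are first identified with the explicit sets
  \<open>point_class p\<close>; on them \<open>kappa_hat\<close>, which is described through rays,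
  can be evaluated.\<close>

locale connected_graph =
  fixes X :: "'x set" and E :: "'x rel"
  assumes edges_subset: "E \<subseteq> X \<times> X"
    and sym_edges: "sym E"
    and connected: "x \<in> X \<Longrightarrow> y \<in> X \<Longrightarrow> (x, y) \<in> E\<^sup>*"
begin

lemma gdist_le_walk: "(x, y) \<in> E ^^ n \<Longrightarrow> gdist E x y \<le> n"
  unfolding gdist_def by (rule Least_le)

lemma walk_gdist: "x \<in> X \<Longrightarrow> y \<in> X \<Longrightarrow> (x, y) \<in> E ^^ gdist E x y"
  unfolding gdist_def by (rule LeastI_ex) (use connected rtrancl_imp_relpow in blast)

lemma gdist_self [simp]: "gdist E x x = 0"
  using gdist_le_walk[of x x 0] by simp

lemma walk_in: "(x, y) \<in> E ^^ n \<Longrightarrow> x \<in> X \<Longrightarrow> y \<in> X"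
  by (induction n arbitrary: y) (use edges_subset in auto)

lemma walk_sym: "(x, y) \<in> E ^^ n \<Longrightarrow> (y, x) \<in> E ^^ n"
proof (induction n arbitrary: y)
  case (Suc n)
  then obtain w where "(x, w) \<in> E ^^ n" "(w, y) \<in> E" by auto
  then show ?case using Suc.IH sym_edges by (meson relpow_Suc_I2 symD)
qed simp

lemma gdist_commute: "x \<in> X \<Longrightarrow> y \<in> X \<Longrightarrow> gdist E x y = gdist E y x"
  by (meson antisym gdist_le_walk walk_gdist walk_sym)

lemma gdist_triangle:
  assumes "x \<in> X" "y \<in> X" "w \<in> X"
  shows "gdist E x y \<le> gdist E x w + gdist E w y"
proof -
  have "(x, y) \<in> E ^^ (gdist E x w + gdist E w y)"
    using walk_gdist[of x w] walk_gdist[of w y] assms by (auto simp: relpow_add)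
  then show ?thesis by (rule gdist_le_walk)
qed

lemma gdist_edge_le: "(x, y) \<in> E \<Longrightarrow> gdist E x y \<le> 1"
  using gdist_le_walk[of x y 1] by simp

lemma gdist_walk_le:
  assumes "w \<in> X" "(x, y) \<in> E ^^ n" "x \<in> X"
  shows "gdist E w y \<le> gdist E w x + n" "gdist E w x \<le> gdist E w y + n"
proof -
  have y: "y \<in> X" using walk_in assms by blast
  have "gdist E x y \<le> n" "gdist E y x \<le> n"
    using gdist_le_walk walk_sym assms by blast+
  then show "gdist E w y \<le> gdist E w x + n" "gdist E w x \<le> gdist E w y + n"
    using gdist_triangle[of w y x] gdist_triangle[of w x y] assms y by linarith+
qed

lemma gdist_edge:
  assumes "w \<in> X" "(x, y) \<in> E"
  shows "gdist E w y \<le> Suc (gdist E w x)" "gdist E w x \<le> Suc (gdist E w y)"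
  using gdist_walk_le[of w x y 1] assms edges_subset by auto

lemma gdist_eq_0_iff: "x \<in> X \<Longrightarrow> y \<in> X \<Longrightarrow> gdist E x y = 0 \<longleftrightarrow> x = y"
  using walk_gdist[of x y] by auto

lemma nearer_neighbour:
  assumes "w \<in> X" "y \<in> X" "gdist E w y = Suc m"
  obtains u where "(u, y) \<in> E" "gdist E w u = m"
proof -
  obtain u where u: "(w, u) \<in> E ^^ m" "(u, y) \<in> E"
    using walk_gdist[of w y] assms by auto
  have "gdist E w u = m"
    using gdist_le_walk[OF u(1)] gdist_edge[OF assms(1) u(2)] assms(3) by linarith
  with u that show ?thesis by blast
qed

lemma walk_imp_list:
  assumes "(x, y) \<in> E ^^ n"
  obtains p where "p \<noteq> []" "hd p = x" "last p = y" "successively (\<lambda>u v. (u, v) \<in> E) p"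
    "length p = Suc n"
proof -
  obtain f where f: "f 0 = x" "f n = y" "\<forall>i<n. (f i, f (Suc i)) \<in> E"
    using assms unfolding relpow_fun_conv by blast
  show ?thesis
  proof
    show "last (map f [0..<Suc n]) = y" using f by simp
    show "hd (map f [0..<Suc n]) = x" using f by (simp del: upt_Suc add: hd_map)
    show "successively (\<lambda>u v. (u, v) \<in> E) (map f [0..<Suc n])"
      using f by (auto simp: successively_conv_nth simp del: upt_Suc)
  qed auto
qed

lemma list_imp_walk:
  assumes "successively (\<lambda>u v. (u, v) \<in> E) p" "i \<le> j" "j < length p"
  shows "(p ! i, p ! j) \<in> E ^^ (j - i)"
  using assms(2,3)
proof (induction j rule: dec_induct)
  case (step j)
  then have "(p ! j, p ! Suc j) \<in> E"
    using assms(1) by (auto simp: successively_conv_nth)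
  with step show ?case by (auto simp: Suc_diff_le)
qed simp

text \<open>A geodesic to \<open>y\<close> that visits \<open>x\<close> at position \<open>i\<close>
  has \<open>gdist E \<theta> x \<le> i\<close>, so \<open>i\<close> can only be the position just
  before \<open>y\<close>; conversely a geodesic to \<open>x\<close> extends by \<open>y\<close>.
  This trades the path-based descendant relation for edges and heights.\<close>

lemma descendants_at_1:
  assumes \<theta>: "\<theta> \<in> X" and x: "x \<in> X"
  shows "descendants_at X E \<theta> 1 x = {y. (x, y) \<in> E \<and> gdist E \<theta> y = Suc (gdist E \<theta> x)}"
proof (intro equalityI subsetI)
  fix y assume "y \<in> descendants_at X E \<theta> 1 x"
  then obtain p where y: "y \<in> X" "gdist E \<theta> y = Suc (gdist E \<theta> x)"
    and p: "geodesic E \<theta> y p" "x \<in> set p"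
    unfolding descendants_at_def descendant_def by auto
  let ?n = "gdist E \<theta> y"
  obtain i where i: "i < length p" "p ! i = x" using p(2) by (auto simp: in_set_conv_nth)
  have s: "successively (\<lambda>u v. (u, v) \<in> E) p" and len: "length p = Suc ?n"
    and "p \<noteq> []" "hd p = \<theta>" "last p = y"
    using p(1) unfolding geodesic_def by blast+
  then have hd: "p ! 0 = \<theta>" and la: "p ! ?n = y"
    by (metis hd_conv_nth, metis last_conv_nth diff_Suc_1)
  have 1: "gdist E \<theta> x \<le> i"
    using list_imp_walk[OF s, of 0 i] i hd gdist_le_walk by auto
  have 2: "(x, y) \<in> E ^^ (?n - i)"
    using list_imp_walk[OF s, of i ?n] i la len by auto
  have "i \<noteq> ?n" using y(2) i la by auto
  with 1 i len y(2) have "?n - i = 1" by linarith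
  with 2 y show "y \<in> {y. (x, y) \<in> E \<and> gdist E \<theta> y = Suc (gdist E \<theta> x)}" by auto
next
  fix y assume "y \<in> {y. (x, y) \<in> E \<and> gdist E \<theta> y = Suc (gdist E \<theta> x)}"
  then have xy: "(x, y) \<in> E" and h: "gdist E \<theta> y = Suc (gdist E \<theta> x)" by auto
  obtain p where p: "p \<noteq> []" "hd p = \<theta>" "last p = x" "successively (\<lambda>u v. (u, v) \<in> E) p"
    "length p = Suc (gdist E \<theta> x)"
    using walk_imp_list[OF walk_gdist[OF \<theta> x]] by blast
  have "geodesic E \<theta> y (p @ [y])"
    unfolding geodesic_def using p xy h by (simp add: successively_append_iff)
  moreover have "x \<in> set (p @ [y])" using p by auto
  moreover have "y \<in> X" using xy edges_subset by auto
  ultimately show "y \<in> descendants_at X E \<theta> 1 x"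
    unfolding descendants_at_def descendant_def using h by auto
qed

text \<open>No edge of \<open>E\<close> raises the \<open>F\<close>-height by more than one, so a
  walk in \<open>E\<close> cannot leave the root faster than one in \<open>F\<close>. It is meant
  for horizontal edges, which preserve tree heights.\<close>

lemma gdist_eq_subgraph:
  assumes F: "connected_graph X F" and sub: "F \<subseteq> E" and \<theta>: "\<theta> \<in> X"
    and lip: "\<And>x y. (x, y) \<in> E \<Longrightarrow> gdist F \<theta> y \<le> Suc (gdist F \<theta> x)"
    and x: "x \<in> X"
  shows "gdist E \<theta> x = gdist F \<theta> x"
proof (rule antisym)
  interpret F: connected_graph X F by fact
  have "(\<theta>, y) \<in> F ^^ n \<Longrightarrow> (\<theta>, y) \<in> E ^^ n" for n y
    by (induction n arbitrary: y) (use sub in auto)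
  then have "(\<theta>, x) \<in> E ^^ gdist F \<theta> x"
    using F.walk_gdist[OF \<theta> x] by blast
  then show "gdist E \<theta> x \<le> gdist F \<theta> x" by (rule gdist_le_walk)
  have "gdist F \<theta> y \<le> n" if "(\<theta>, y) \<in> E ^^ n" for n y
    using that
  proof (induction n arbitrary: y)
    case (Suc n)
    then obtain w where "(\<theta>, w) \<in> E ^^ n" "(w, y) \<in> E" by auto
    then show ?case using Suc.IH[of w] lip[of w y] by simp
  qed simp
  then show "gdist F \<theta> x \<le> gdist E \<theta> x" using walk_gdist[OF \<theta> x] by blast
qed

end

section \<open>Quasi-metrics\<close>

locale quasi_metric =
  fixes K :: "'k set" and \<rho> :: "'k \<Rightarrow> 'k \<Rightarrow> real" and C :: real
  assumes nonneg: "p \<in> K \<Longrightarrow> q \<in> K \<Longrightarrow> 0 \<le> \<rho> p q"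
    and zero_iff: "p \<in> K \<Longrightarrow> q \<in> K \<Longrightarrow> \<rho> p q = 0 \<longleftrightarrow> p = q"
    and commute: "p \<in> K \<Longrightarrow> q \<in> K \<Longrightarrow> \<rho> p q = \<rho> q p"
    and C_ge_1: "1 \<le> C"
    and triangle: "p \<in> K \<Longrightarrow> q \<in> K \<Longrightarrow> w \<in> K \<Longrightarrow> \<rho> p q \<le> C * (\<rho> p w + \<rho> w q)"
begin

text \<open>The factor \<open>C ^ n\<close> is affordable because only chains of bounded length are
  treated in this way.\<close>

lemma chain_le:
  assumes "\<And>i. i \<le> n \<Longrightarrow> q i \<in> K" "\<And>i. i < n \<Longrightarrow> \<rho> (q i) (q (Suc i)) \<le> e" "0 \<le> e"
  shows "\<rho> (q 0) (q n) \<le> real n * C ^ n * e"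
  using assms(1,2)
proof (induction n)
  case 0
  then show ?case using zero_iff[of "q 0" "q 0"] by simp
next
  case (Suc n)
  have "\<rho> (q 0) (q (Suc n)) \<le> C * (\<rho> (q 0) (q n) + \<rho> (q n) (q (Suc n)))"
    using Suc.prems(1) by (intro triangle) auto
  also have "\<dots> \<le> C * (real n * C ^ n * e + C ^ n * e)"
  proof -
    have "e \<le> C ^ n * e" using mult_right_mono[OF one_le_power[OF C_ge_1] assms(3)] by simp
    moreover have "\<rho> (q 0) (q n) \<le> real n * C ^ n * e" using Suc by simp
    moreover have "\<rho> (q n) (q (Suc n)) \<le> e" using Suc.prems(2) by simp
    ultimately show ?thesis using C_ge_1 by (intro mult_left_mono) auto
  qed
  also have "\<dots> = real (Suc n) * C ^ Suc n * e" by (simp add: algebra_simps)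
  finally show ?case .
qed

text \<open>A plain induction on \<open>n\<close> would need \<open>C * r < 1\<close>; blocks of \<open>N\<close> steps with
  \<open>C * r ^ N \<le> 1/2\<close> avoid this.\<close>

lemma geometric_chain:
  assumes r: "0 < r" "r < 1"
  obtains B where "0 < B"
    "\<And>n q e. 0 \<le> e \<Longrightarrow> (\<And>i. i \<le> n \<Longrightarrow> q i \<in> K) \<Longrightarrow>
       (\<And>i. i < n \<Longrightarrow> \<rho> (q i) (q (Suc i)) \<le> e / r ^ i) \<Longrightarrow> \<rho> (q 0) (q n) \<le> B * e / r ^ n"
proof -
  have C0: "0 < C" using C_ge_1 by simp
  obtain N where N: "r ^ N < 1 / (2 * C)"
    using real_arch_pow_inv[of "1 / (2 * C)" r] r C0 by auto
  define D where "D = real N * C ^ N"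
  \<comment> \<open>The recursion below needs \<open>B / 2 + C * D \<le> B\<close>, hence
    \<open>2 * C * D\<close>; the summand \<open>D\<close> covers chains of at most \<open>N\<close>
    steps, and \<open>1\<close> makes \<open>B\<close> positive.\<close>
  define B where "B = 2 * C * D + D + 1"
  have D0: "0 \<le> D" using C0 by (simp add: D_def)
  have B0: "0 < B" using C0 D0 by (simp add: B_def add_nonneg_pos)
  have rC: "C * r ^ N \<le> 1 / 2" using N C0 by (simp add: field_simps)
  have N0: "N > 0"
    using rC C_ge_1 by (cases N) auto
  have block: "\<rho> (q k) (q (k + m)) \<le> D * e / r ^ (k + m)"
    if e: "0 \<le> e" and q: "\<And>i. i \<le> k + m \<Longrightarrow> q i \<in> K"
      and st: "\<And>i. i < k + m \<Longrightarrow> \<rho> (q i) (q (Suc i)) \<le> e / r ^ i" and m: "m \<le> N"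
    for k m :: nat and q e
  proof -
    have "\<rho> (q (k + 0)) (q (k + m)) \<le> real m * C ^ m * (e / r ^ (k + m))"
    proof (rule chain_le)
      fix i assume i: "i < m"
      have "\<rho> (q (k + i)) (q (k + Suc i)) \<le> e / r ^ (k + i)" using st[of "k + i"] i by simp
      also have "\<dots> \<le> e / r ^ (k + m)"
        using e r i by (intro divide_left_mono power_decreasing) auto
      finally show "\<rho> (q (k + i)) (q (k + Suc i)) \<le> e / r ^ (k + m)" .
    qed (use q e r in auto)
    also have "\<dots> \<le> D * (e / r ^ (k + m))"
      unfolding D_def using m C_ge_1 e r
      by (intro mult_right_mono mult_mono power_increasing) auto
    finally show ?thesis by simp
  qed
  have "\<rho> (q 0) (q n) \<le> B * e / r ^ n"
    if e: "0 \<le> e" and q: "\<And>i. i \<le> n \<Longrightarrow> q i \<in> K"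
      and st: "\<And>i. i < n \<Longrightarrow> \<rho> (q i) (q (Suc i)) \<le> e / r ^ i" for n q e
    using q st
  proof (induction n rule: less_induct)
    case (less n)
    have DB: "D * (e / r ^ n) \<le> B * (e / r ^ n)"
      using e r C0 D0 by (intro mult_right_mono) (auto simp: B_def)
    show ?case
    proof (cases "n \<le> N")
      case True
      then have "\<rho> (q 0) (q n) \<le> D * e / r ^ n"
        using block[of e 0 n q] e less.prems by simp
      then show ?thesis using DB by simp
    next
      case False
      \<comment> \<open>The block is cut off at the end, where the steps may be largest: relative to
        \<open>e / r ^ n\<close> the initial part carries the factor \<open>r ^ N\<close>, which
        pays for the \<open>C\<close> of the triangle inequality.\<close>
      define m where "m = n - N"
      have n: "n = m + N" using False by (simp add: m_def)
      have "\<rho> (q 0) (q m) \<le> B * e / r ^ m"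
        using less n N0 by auto
      also have "\<dots> = B * r ^ N * (e / r ^ n)"
        using r by (simp add: n power_add)
      finally have 1: "\<rho> (q 0) (q m) \<le> B * r ^ N * (e / r ^ n)" .
      have 2: "\<rho> (q m) (q n) \<le> D * (e / r ^ n)"
        using block[of e m N q] e less.prems by (simp add: n)
      have "\<rho> (q 0) (q n) \<le> C * (\<rho> (q 0) (q m) + \<rho> (q m) (q n))"
        using less.prems n by (intro triangle) auto
      also have "\<dots> \<le> C * (B * r ^ N * (e / r ^ n) + D * (e / r ^ n))"
        using 1 2 C0 by (intro mult_left_mono add_mono) auto
      also have "\<dots> = (B * (C * r ^ N) + C * D) * (e / r ^ n)"
        by (simp add: algebra_simps)
      also have "\<dots> \<le> B * (e / r ^ n)"
      proof (rule mult_right_mono)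
        have "B * (C * r ^ N) \<le> B * (1 / 2)" using rC B0 by (intro mult_left_mono) auto
        then show "B * (C * r ^ N) + C * D \<le> B" using D0 by (simp add: B_def)
      qed (use e r in auto)
      finally show ?thesis by simp
    qed
  qed
  with B0 that show ?thesis by blast
qed

section \<open>Sequences in compact sets\<close>

lemma compactin_cluster_point:
  assumes balls: "\<And>p e. p \<in> K \<Longrightarrow> openin (qtopology K \<rho>) (qball K \<rho> p e)"
    and S: "compactin (qtopology K \<rho>) S" and f: "\<And>n::nat. f n \<in> S"
  obtains q where "q \<in> S" "\<And>e. 0 < e \<Longrightarrow> infinite {n. \<rho> q (f n) < e}"
proof (rule ccontr)
  assume "\<not> thesis"
  \<comment> \<open>Balls that catch only finitely many indices would cover \<open>S\<close>; they
    are open by assumption, not by the quasi-metric axioms, and a finite subcover would make the set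
    of all indices finite. Counting indices instead of values takes care of repeated terms.\<close>
  then have "\<forall>q\<in>S. \<exists>e>0. finite {n. \<rho> q (f n) < e}" using that by blast
  then obtain e where e: "\<And>q. q \<in> S \<Longrightarrow> 0 < e q \<and> finite {n. \<rho> q (f n) < e q}"
    by metis
  have SK: "S \<subseteq> K" using compactin_subset_topspace[OF S] by simp
  have "S \<subseteq> (\<Union>q\<in>S. qball K \<rho> q (e q))"
    using SK e zero_iff by (force simp: qball_def)
  then obtain T where T: "finite T" "T \<subseteq> S" "S \<subseteq> (\<Union>q\<in>T. qball K \<rho> q (e q))"
    using S balls SK unfolding compactin_def
    by (smt (verit, ccfv_threshold) finite_subset_image image_iff subsetD)
  have "(UNIV :: nat set) \<subseteq> (\<Union>q\<in>T. {n. \<rho> q (f n) < e q})"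
    using T(3) f by (fastforce simp: qball_def)
  moreover have "finite (\<Union>q\<in>T. {n. \<rho> q (f n) < e q})" using T e by blast
  ultimately show False using finite_subset infinite_UNIV_nat by blast
qed

text \<open>That the limit lies in \<open>S\<close> matters as much as its existence: for
  \<open>S\<close> a cell \<open>\<Phi> x\<close> this keeps limits of centres inside the
  cell.\<close>

lemma compactin_Cauchy_limit:
  assumes balls: "\<And>p e. p \<in> K \<Longrightarrow> openin (qtopology K \<rho>) (qball K \<rho> p e)"
    and S: "compactin (qtopology K \<rho>) S" and f: "\<And>n::nat. f n \<in> S"
    and Cauchy: "\<And>e. 0 < e \<Longrightarrow> \<exists>N. \<forall>m\<ge>N. \<forall>n\<ge>N. \<rho> (f m) (f n) < e"
  obtains q where "q \<in> S" "(\<lambda>n. \<rho> (f n) q) \<longlonglongrightarrow> 0"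
proof -
  obtain q where q: "q \<in> S" "\<And>e. 0 < e \<Longrightarrow> infinite {n. \<rho> q (f n) < e}"
    using compactin_cluster_point[where f = f, OF balls S f] by blast
  have SK: "S \<subseteq> K" using compactin_subset_topspace[OF S] by simp
  have C0: "0 < C" using C_ge_1 by simp
  have "(\<lambda>n. \<rho> (f n) q) \<longlonglongrightarrow> 0"
  proof (rule LIMSEQ_I)
    fix e :: real assume e: "0 < e"
    obtain N where N: "\<forall>m\<ge>N. \<forall>n\<ge>N. \<rho> (f m) (f n) < e / (2 * C)"
      using Cauchy[of "e / (2 * C)"] e C0 by auto
    obtain m where m: "m \<ge> N" "\<rho> q (f m) < e / (2 * C)"
      using q(2)[of "e / (2 * C)"] e C0 by (auto simp: infinite_nat_iff_unbounded_le)
    have "norm (\<rho> (f n) q - 0) < e" if "n \<ge> N" for n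
    proof -
      have "\<rho> (f n) q \<le> C * (\<rho> (f n) (f m) + \<rho> (f m) q)"
        using f q SK by (intro triangle) auto
      also have "\<dots> < C * (e / (2 * C) + e / (2 * C))"
        using N m that C0 commute[OF subsetD[OF SK q(1)] subsetD[OF SK f[of m]]]
        by (intro mult_strict_left_mono add_strict_mono) auto
      also have "\<dots> = e" using C0 by (simp add: field_simps)
      finally show ?thesis using nonneg[OF subsetD[OF SK f[of n]] subsetD[OF SK q(1)]] by simp
    qed
    then show "\<exists>no. \<forall>n\<ge>no. norm (\<rho> (f n) q - 0) < e" by blast
  qed
  with q that show ?thesis by blast
qed

lemma limit_unique:
  assumes "p \<in> K" "q \<in> K" "\<And>n. f n \<in> K" "(\<lambda>n. \<rho> (f n) p) \<longlonglongrightarrow> 0" "(\<lambda>n. \<rho> (f n) q) \<longlonglongrightarrow> 0"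
  shows "p = q"
proof -
  have "(\<lambda>n. C * (\<rho> (f n) p + \<rho> (f n) q)) \<longlonglongrightarrow> C * (0 + 0)"
    by (intro tendsto_intros assms)
  moreover have "\<rho> p q \<le> C * (\<rho> (f n) p + \<rho> (f n) q)" for n
    using triangle[of p q "f n"] commute[of p "f n"] assms by simp
  ultimately have "\<rho> p q \<le> C * (0 + 0)" by (meson LIMSEQ_le_const)
  then show ?thesis using nonneg[of p q] zero_iff[of p q] assms by simp
qed

end

text \<open>Openness in \<open>qtopology\<close> is tested by balls alone, so it suffices to convert
  radii: \<open>e\<close> becomes \<open>inverse D * e powr \<alpha>\<close> in one direction and
  \<open>(e / D) powr (1 / \<alpha>)\<close> in the other.\<close>

lemma homeomorphic_map_qtopology_Hoelder:
  fixes \<alpha> D :: real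
  assumes f: "bij_betw f A K" and \<alpha>: "0 < \<alpha>" and D: "0 < D"
    and nonneg: "\<And>p q. p \<in> K \<Longrightarrow> q \<in> K \<Longrightarrow> 0 \<le> \<rho> p q"
    and lower: "\<And>x y. x \<in> A \<Longrightarrow> y \<in> A \<Longrightarrow> inverse D * \<rho> (f x) (f y) powr \<alpha> \<le> d x y"
    and upper: "\<And>x y. x \<in> A \<Longrightarrow> y \<in> A \<Longrightarrow> d x y \<le> D * \<rho> (f x) (f y) powr \<alpha>"
  shows "homeomorphic_map (qtopology A d) (qtopology K \<rho>) f"
proof (rule bijective_open_imp_homeomorphic_map)
  have fA: "f ` A = K" and inj: "inj_on f A" using f by (auto simp: bij_betw_def)
  show "f ` topspace (qtopology A d) = topspace (qtopology K \<rho>)" "inj_on f (topspace (qtopology A d))"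
    using fA inj by auto
  show "continuous_map (qtopology A d) (qtopology K \<rho>) f"
    unfolding continuous_map
  proof (intro conjI allI impI)
    fix U assume U: "openin (qtopology K \<rho>) U"
    have "\<exists>\<epsilon>>0. qball A d x \<epsilon> \<subseteq> {x \<in> A. f x \<in> U}" if x: "x \<in> A" "f x \<in> U" for x
    proof -
      obtain e where e: "e > 0" "qball K \<rho> (f x) e \<subseteq> U" using U x unfolding openin_qtopology by blast
      have "y \<in> {x \<in> A. f x \<in> U}" if y: "y \<in> qball A d x (inverse D * e powr \<alpha>)" for y
      proof -
        have yA: "y \<in> A" "d x y < inverse D * e powr \<alpha>" using y by (auto simp: qball_def)
        have "inverse D * \<rho> (f x) (f y) powr \<alpha> < inverse D * e powr \<alpha>"
          using lower[OF x(1) yA(1)] yA(2) by linarith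
        then have "\<rho> (f x) (f y) powr \<alpha> < e powr \<alpha>" using D by simp
        then have "\<rho> (f x) (f y) < e"
          using \<alpha> e(1) by (meson not_less order_less_imp_le powr_mono2)
        then show ?thesis using e(2) yA fA by (auto simp: qball_def)
      qed
      moreover have "inverse D * e powr \<alpha> > 0" using D e by simp
      ultimately show ?thesis by blast
    qed
    then show "openin (qtopology A d) {x \<in> topspace (qtopology A d). f x \<in> U}"
      unfolding openin_qtopology by auto
  qed (use fA in auto)
  show "open_map (qtopology A d) (qtopology K \<rho>) f"
    unfolding open_map_def
  proof (intro allI impI)
    fix U assume U: "openin (qtopology A d) U"
    then have UA: "U \<subseteq> A" unfolding openin_qtopology by blast
    have "\<exists>\<epsilon>>0. qball K \<rho> (f x) \<epsilon> \<subseteq> f ` U" if x: "x \<in> U" for x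
    proof -
      obtain e where e: "e > 0" "qball A d x e \<subseteq> U" using U x unfolding openin_qtopology by blast
      have "f y \<in> f ` U" if y: "y \<in> A" "\<rho> (f x) (f y) < (e / D) powr (1 / \<alpha>)" for y
      proof -
        have "d x y \<le> D * \<rho> (f x) (f y) powr \<alpha>" using upper x UA y by auto
        also have "\<dots> < D * ((e / D) powr (1 / \<alpha>)) powr \<alpha>"
          using D \<alpha> y nonneg x UA fA
          by (intro mult_strict_left_mono powr_less_mono2) auto
        also have "\<dots> = e" using D e \<alpha> by (simp add: powr_powr)
        finally show ?thesis using e(2) y by (auto simp: qball_def)
      qed
      then have "qball K \<rho> (f x) ((e / D) powr (1 / \<alpha>)) \<subseteq> f ` U"
        using fA by (auto simp: qball_def)
      moreover have "(e / D) powr (1 / \<alpha>) > 0" using e D by simp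
      ultimately show ?thesis by blast
    qed
    then show "openin (qtopology K \<rho>) (f ` U)" unfolding openin_qtopology using UA fA by auto
  qed
qed

section \<open>Gromov products and the quasi-metric\<close>

text \<open>Heights are taken in the augmented graph \<open>E\<close> itself, where they agree with those in the
  tree; so neither the tree nor the measure has to be mentioned.\<close>

locale hyperbolic_model = quasi_metric K \<rho> C + connected_graph X E
  for K :: "'k set" and \<rho> :: "'k \<Rightarrow> 'k \<Rightarrow> real" and C :: real and X :: "'x set" and E :: "'x rel" +
  fixes \<theta> :: 'x and \<Phi> :: "'x \<Rightarrow> 'k set" and z :: "'x \<Rightarrow> 'k" and r c \<gamma> :: real
  assumes balls_open: "p \<in> K \<Longrightarrow> openin (qtopology K \<rho>) (qball K \<rho> p e)"
    and root: "\<theta> \<in> X"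
    and \<Phi>_compact: "x \<in> X \<Longrightarrow> compactin (qtopology K \<rho>) (\<Phi> x)"
    and \<Phi>_root: "\<Phi> \<theta> = K"
    and \<Phi>_children:
      "x \<in> X \<Longrightarrow> \<Phi> x = (\<Union>y\<in>{y. (x, y) \<in> E \<and> gdist E \<theta> y = Suc (gdist E \<theta> x)}. \<Phi> y)"
    and centre: "x \<in> X \<Longrightarrow> z x \<in> \<Phi> x"
    and \<Phi>_small: "x \<in> X \<Longrightarrow> p \<in> \<Phi> x \<Longrightarrow> \<rho> (z x) p < c * r ^ gdist E \<theta> x"
    and r: "0 < r" "r < 1"
    and c: "0 < c"
    and \<gamma>: "0 < \<gamma>"
    and adjacent_near: "(x, y) \<in> E \<Longrightarrow> gdist E \<theta> x = gdist E \<theta> y \<Longrightarrow>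
       \<exists>p\<in>\<Phi> x. \<exists>q\<in>\<Phi> y. \<rho> p q \<le> 2 * \<gamma> * r ^ gdist E \<theta> x"
    and near_adjacent: "x \<in> X \<Longrightarrow> y \<in> X \<Longrightarrow> gdist E \<theta> x = gdist E \<theta> y \<Longrightarrow>
       p \<in> \<Phi> x \<Longrightarrow> q \<in> \<Phi> y \<Longrightarrow> \<rho> p q \<le> \<gamma> * r ^ gdist E \<theta> x \<Longrightarrow> x = y \<or> (x, y) \<in> E"
begin

abbreviation h :: "'x \<Rightarrow> nat" where "h \<equiv> gdist E \<theta>"

abbreviation gp :: "'x \<Rightarrow> 'x \<Rightarrow> real" where "gp \<equiv> gromov_product E \<theta>"

definition R :: "'x \<Rightarrow> 'x \<Rightarrow> real" where
  "R x y = r ^ h x + r ^ h y + \<rho> (z x) (z y)"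

lemma edge_in: "(x, y) \<in> E \<Longrightarrow> x \<in> X" "(x, y) \<in> E \<Longrightarrow> y \<in> X"
  using edges_subset by auto

lemma \<Phi>_subset: "x \<in> X \<Longrightarrow> \<Phi> x \<subseteq> K"
  using compactin_subset_topspace[OF \<Phi>_compact] by simp

lemma centre_in: "x \<in> X \<Longrightarrow> z x \<in> K"
  using centre \<Phi>_subset by blast

lemma \<Phi>_child: "(x, y) \<in> E \<Longrightarrow> h y = Suc (h x) \<Longrightarrow> \<Phi> y \<subseteq> \<Phi> x"
  using \<Phi>_children[of x] edge_in by blast

lemma C0: "0 < C"
  using C_ge_1 by simp

lemma le_C_mult: "0 \<le> t \<Longrightarrow> t \<le> C * t"
  using mult_right_mono[OF C_ge_1, of t] by simp

lemma R_pos: "x \<in> X \<Longrightarrow> y \<in> X \<Longrightarrow> 0 < R x y"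
  unfolding R_def using r nonneg[OF centre_in centre_in, of x y] zero_less_power[of r]
  by (simp add: add_pos_nonneg add_pos_pos)

lemma R_triangle:
  assumes "x \<in> X" "y \<in> X" "w \<in> X"
  shows "R x y \<le> C * (R x w + R w y)"
proof -
  have "r ^ h x \<le> C * r ^ h x" "r ^ h y \<le> C * r ^ h y" "0 \<le> C * r ^ h w"
    using r C0 le_C_mult by auto
  moreover have "\<rho> (z x) (z y) \<le> C * (\<rho> (z x) (z w) + \<rho> (z w) (z y))"
    using assms by (intro triangle centre_in)
  ultimately show ?thesis unfolding R_def by (simp add: algebra_simps)
qed

section \<open>Upper bound for \<open>R\<close>: displacement of centres along walks\<close>

lemma edge_le:
  obtains A where "0 < A" "\<And>u v. (u, v) \<in> E \<Longrightarrow> \<rho> (z u) (z v) \<le> A * r ^ h u"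
proof -
  \<comment> \<open>\<open>c / r\<close> serves vertical edges in both directions, where one cell
    contains the other and their scales differ by the factor \<open>r\<close>; the other summand
    comes from two triangle inequalities along \<open>z u\<close>, \<open>p\<close>,
    \<open>q\<close>, \<open>z v\<close> for a horizontal edge.\<close>
  define A where "A = c / r + C * (c + C * (2 * \<gamma> + c))"
  have A0: "0 < A" "c \<le> A" "c / r \<le> A" "C * (c + C * (2 * \<gamma> + c)) \<le> A"
  proof -
    have "0 < C * (c + C * (2 * \<gamma> + c))" using c \<gamma> C0 by (simp add: add_pos_pos)
    moreover have "c \<le> c / r" using r c by (simp add: field_simps)
    ultimately show "0 < A" "c \<le> A" "c / r \<le> A" "C * (c + C * (2 * \<gamma> + c)) \<le> A"
      unfolding A_def using c r by (smt (verit) divide_pos_pos)+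
  qed
  have "\<rho> (z u) (z v) \<le> A * r ^ h u" if uv: "(u, v) \<in> E" for u v
  proof -
    have X: "u \<in> X" "v \<in> X" using uv edge_in by auto
    have vu: "(v, u) \<in> E" using uv sym_edges by (meson symD)
    consider "h v = Suc (h u)" | "h u = Suc (h v)" | "h u = h v"
      using gdist_edge[OF root uv] by linarith
    then show ?thesis
    proof cases
      case 1
      then have "z v \<in> \<Phi> u" using \<Phi>_child[OF uv] centre[OF X(2)] by auto
      then have "\<rho> (z u) (z v) \<le> c * r ^ h u" using \<Phi>_small[OF X(1)] by fastforce
      also have "\<dots> \<le> A * r ^ h u" using A0 r by (intro mult_right_mono) auto
      finally show ?thesis .
    next
      case 2
      then have "z u \<in> \<Phi> v" using \<Phi>_child[OF vu] centre[OF X(1)] by auto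
      then have "\<rho> (z u) (z v) \<le> c * r ^ h v"
        using \<Phi>_small[OF X(2)] commute[OF centre_in centre_in, of u v] X by fastforce
      also have "\<dots> = c / r * r ^ h u" using 2 r by simp
      also have "\<dots> \<le> A * r ^ h u" using A0 r by (intro mult_right_mono) auto
      finally show ?thesis .
    next
      case 3
      then obtain p q where pq: "p \<in> \<Phi> u" "q \<in> \<Phi> v" "\<rho> p q \<le> 2 * \<gamma> * r ^ h u"
        using adjacent_near[OF uv] by blast
      have K: "p \<in> K" "q \<in> K" using pq \<Phi>_subset X by auto
      have 1: "\<rho> (z u) p \<le> c * r ^ h u" "\<rho> q (z v) \<le> c * r ^ h u"
        using \<Phi>_small[OF X(1) pq(1)] \<Phi>_small[OF X(2) pq(2)] 3
          commute[OF K(2) centre_in[OF X(2)]] by auto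
      have "\<rho> (z u) (z v) \<le> C * (\<rho> (z u) p + \<rho> p (z v))"
        using K X by (intro triangle centre_in)
      also have "\<dots> \<le> C * (\<rho> (z u) p + C * (\<rho> p q + \<rho> q (z v)))"
        using K X C0 triangle[OF K(1) centre_in[OF X(2)] K(2)] by (intro mult_left_mono add_left_mono) auto
      also have "\<dots> \<le> C * (c * r ^ h u + C * (2 * \<gamma> * r ^ h u + c * r ^ h u))"
        using C0 1 pq by (intro mult_left_mono add_mono) auto
      also have "\<dots> = (C * (c + C * (2 * \<gamma> + c))) * r ^ h u" by (simp add: algebra_simps)
      also have "\<dots> \<le> A * r ^ h u" using A0 r by (intro mult_right_mono) auto
      finally show ?thesis .
    qed
  qed
  with A0 that show ?thesis by blast
qed

text \<open>Each step lowers the height by at most one, so the step from the \<open>i\<close>-th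
  vertex moves the centre by at most \<open>A * r ^ h x / r ^ i\<close>, and
  \<open>geometric_chain\<close> sums these. The quotient of powers stands for the exponent
  \<open>h x - n\<close>, which may be negative.\<close>

lemma walk_le:
  obtains B where "0 < B"
    "\<And>n x y. x \<in> X \<Longrightarrow> (x, y) \<in> E ^^ n \<Longrightarrow> \<rho> (z x) (z y) \<le> B * r ^ h x / r ^ n"
proof -
  obtain A where A: "0 < A" "\<And>u v. (u, v) \<in> E \<Longrightarrow> \<rho> (z u) (z v) \<le> A * r ^ h u"
    using edge_le by blast
  obtain B where B: "0 < B"
    "\<And>n q e. 0 \<le> e \<Longrightarrow> (\<And>i. i \<le> n \<Longrightarrow> q i \<in> K) \<Longrightarrow>
       (\<And>i. i < n \<Longrightarrow> \<rho> (q i) (q (Suc i)) \<le> e / r ^ i) \<Longrightarrow> \<rho> (q 0) (q n) \<le> B * e / r ^ n"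
    using geometric_chain[OF r] by blast
  have "\<rho> (z x) (z y) \<le> (B * A) * r ^ h x / r ^ n" if x: "x \<in> X" and w: "(x, y) \<in> E ^^ n" for n x y
  proof -
    obtain f where f: "f 0 = x" "f n = y" "\<forall>i<n. (f i, f (Suc i)) \<in> E"
      using w unfolding relpow_fun_conv by blast
    have walk: "(x, f i) \<in> E ^^ i" if "i \<le> n" for i
      unfolding relpow_fun_conv using f that by (intro exI[of _ f]) auto
    have "\<rho> (z (f 0)) (z (f n)) \<le> B * (A * r ^ h x) / r ^ n"
    proof (rule B(2))
      fix i assume i: "i < n"
      have "h x \<le> h (f i) + i" using gdist_walk_le[OF root walk x] i by simp
      then have "r ^ (h (f i) + i) \<le> r ^ h x" using r by (intro power_decreasing) auto
      then have "r ^ h (f i) \<le> r ^ h x / r ^ i" using r by (simp add: power_add field_simps)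
      then have "A * r ^ h (f i) \<le> A * (r ^ h x / r ^ i)" using A by (intro mult_left_mono) auto
      then show "\<rho> (z (f i)) (z (f (Suc i))) \<le> A * r ^ h x / r ^ i"
        using A(2)[of "f i" "f (Suc i)"] f i by fastforce
    next
      fix i assume "i \<le> n"
      then show "z (f i) \<in> K" using centre_in walk_in[OF walk x] by blast
    qed (use A r in auto)
    then show ?thesis using f by (simp add: mult.assoc)
  qed
  moreover have "0 < B * A" using A B by simp
  ultimately show ?thesis using that by blast
qed

text \<open>A geodesic from \<open>x\<close> to \<open>y\<close> is split where the lower bounds \<open>h x - i\<close> and \<open>h y - (n - i)\<close>
  for the height of its \<open>i\<close>-th vertex agree; both are then about \<open>gp x y\<close>.\<close>

lemma R_le_product:
  obtains B where "0 < B" "\<And>x y. x \<in> X \<Longrightarrow> y \<in> X \<Longrightarrow> R x y \<le> B * r powr gp x y"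
proof -
  obtain B where B: "0 < B"
    "\<And>n x y. x \<in> X \<Longrightarrow> (x, y) \<in> E ^^ n \<Longrightarrow> \<rho> (z x) (z y) \<le> B * r ^ h x / r ^ n"
    using walk_le by blast
  have "R x y \<le> (2 + 2 * C * B / r) * r powr gp x y" if X: "x \<in> X" "y \<in> X" for x y
  proof -
    define n where "n = gdist E x y"
    have w: "(x, y) \<in> E ^^ n" using walk_gdist X by (simp add: n_def)
    have hh: "h y \<le> h x + n" "h x \<le> h y + n" using gdist_walk_le[OF root w X(1)] by auto
    have g: "gp x y = (real (h x) + real (h y) - real n) / 2"
      by (simp add: gromov_product_def n_def)
    \<comment> \<open>\<open>i\<close> solves \<open>h x - i = h y - (n - i)\<close>, rounded down;
      without rounding both sides equal \<open>gp x y\<close>. By \<open>hh\<close> neither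
      subtraction is truncated. The allowance of 1 in \<open>gij\<close> absorbs the rounding and
      becomes a factor \<open>1 / r\<close>.\<close>
    define i j where "i = (h x + n - h y) div 2" and "j = n - i"
    have ij: "n = i + j" "2 * i \<le> h x + n - h y" "h x + n - h y \<le> 2 * i + 1"
      using hh by (auto simp: i_def j_def)
    have real_ij: "real n = real i + real j" "2 * real i \<le> real (h x) + real n - real (h y)"
      "real (h x) + real n - real (h y) \<le> 2 * real i + 1"
      using ij hh by linarith+
    have gij: "gp x y - 1 \<le> real (h x) - real i" "gp x y - 1 \<le> real (h y) - real j"
      using real_ij by (simp_all add: g field_simps)
    obtain m where m: "(x, m) \<in> E ^^ i" "(m, y) \<in> E ^^ j"
      using w ij(1) by (auto simp: relpow_add)
    have mX: "m \<in> X" using walk_in m X by blast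
    have pw: "r ^ k / r ^ l \<le> r powr gp x y / r" if "gp x y - 1 \<le> real k - real l" for k l
    proof -
      have "r ^ k / r ^ l = r powr (real k - real l)" using r by (simp add: powr_diff powr_realpow)
      also have "\<dots> \<le> r powr (gp x y - 1)" using r that by (intro powr_mono') auto
      finally show ?thesis using r by (simp add: powr_diff)
    qed
    have "\<rho> (z x) (z m) \<le> B * (r ^ h x / r ^ i)" using B(2)[OF X(1) m(1)] by simp
    also have "\<dots> \<le> B * (r powr gp x y / r)"
      using B gij by (intro mult_left_mono pw) auto
    finally have 1: "\<rho> (z x) (z m) \<le> B * (r powr gp x y / r)" .
    have "\<rho> (z y) (z m) \<le> B * (r ^ h y / r ^ j)" using B(2)[OF X(2) walk_sym[OF m(2)]] by simp
    also have "\<dots> \<le> B * (r powr gp x y / r)"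
      using B gij by (intro mult_left_mono pw) auto
    finally have 2: "\<rho> (z m) (z y) \<le> B * (r powr gp x y / r)"
      using commute centre_in X mX by simp
    have "\<rho> (z x) (z y) \<le> C * (\<rho> (z x) (z m) + \<rho> (z m) (z y))"
      using X mX by (intro triangle centre_in)
    also have "\<dots> \<le> C * (B * (r powr gp x y / r) + B * (r powr gp x y / r))"
      using 1 2 C0 by (intro mult_left_mono add_mono) auto
    finally have 3: "\<rho> (z x) (z y) \<le> 2 * C * B / r * r powr gp x y" by (simp add: algebra_simps)
    have "r ^ k \<le> r powr gp x y" if "gp x y \<le> real k" for k
      using powr_mono'[OF that, of r] r by (simp add: powr_realpow)
    then have "r ^ h x \<le> r powr gp x y" "r ^ h y \<le> r powr gp x y" using hh by (auto simp: g)
    then show ?thesis using 3 unfolding R_def by (simp add: algebra_simps)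
  qed
  moreover have "0 < 2 + 2 * C * B / r" using C0 B r by (simp add: add_pos_pos)
  ultimately show ?thesis using that by blast
qed

section \<open>Lower bound for \<open>R\<close>: ancestors on a common level\<close>

lemma ancestor:
  assumes "x \<in> X" "h x = m + k"
  shows "\<exists>u\<in>X. h u = m \<and> gdist E u x \<le> k \<and> \<Phi> x \<subseteq> \<Phi> u"
  using assms
proof (induction k arbitrary: x)
  case 0
  then show ?case by force
next
  case (Suc k)
  then obtain w where w: "(w, x) \<in> E" "h w = m + k"
    using nearer_neighbour[OF root, of x "m + k"] by auto
  then obtain u where u: "u \<in> X" "h u = m" "gdist E u w \<le> k" "\<Phi> w \<subseteq> \<Phi> u"
    using Suc.IH[of w] edge_in by blast
  have "gdist E u x \<le> Suc k"
    using gdist_edge(1)[OF u(1) w(1)] u by simp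
  moreover have "\<Phi> x \<subseteq> \<Phi> u" using \<Phi>_child[OF w(1)] w(2) Suc.prems u by auto
  ultimately show ?case using u by blast
qed

lemma gp_nonneg: "x \<in> X \<Longrightarrow> y \<in> X \<Longrightarrow> 0 \<le> gp x y"
  using gdist_triangle[OF _ _ root, of x y] gdist_commute[OF _ root, of x]
  by (simp add: gromov_product_def)

text \<open>If \<open>R x y\<close> is about \<open>r ^ m\<close>, the ancestors of \<open>x\<close> and \<open>y\<close> at level \<open>m\<close> are equal or adjacent.\<close>

lemma product_le_R:
  obtains B where "0 < B" "\<And>x y. x \<in> X \<Longrightarrow> y \<in> X \<Longrightarrow> r powr gp x y \<le> B * R x y"
proof -
  \<comment> \<open>\<open>g \<le> \<gamma>\<close> makes the ancestors equal or adjacent;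
    \<open>g \<le> 1\<close> keeps the chosen level from exceeding \<open>h x\<close> and
    \<open>h y\<close>, see \<open>bd\<close>.\<close>
  define g where "g = min \<gamma> 1"
  have g: "0 < g" "g \<le> \<gamma>" "g \<le> 1" using \<gamma> by (auto simp: g_def)
  have "r powr gp x y \<le> 1 / (g * r\<^sup>2) * R x y" if X: "x \<in> X" "y \<in> X" for x y
  proof (cases "R x y \<le> g")
    \<comment> \<open>Here no level qualifies, not even 0. But \<open>R x y\<close> is bounded
      below, so \<open>0 \<le> gp x y\<close> is enough.\<close>
    case False
    have "r powr gp x y \<le> 1" using gp_nonneg[OF X] r by (simp add: powr_le1)
    also have "\<dots> \<le> 1 / g * R x y" using False g by (simp add: field_simps)
    also have "\<dots> \<le> 1 / (g * r\<^sup>2) * R x y"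
    proof (rule mult_right_mono)
      have "g * r\<^sup>2 \<le> g * 1" using g r by (intro mult_left_mono) (auto simp: power_le_one)
      then show "1 / g \<le> 1 / (g * r\<^sup>2)" using g r by (intro divide_left_mono) auto
    qed (use R_pos X in \<open>auto intro: less_imp_le\<close>)
    finally show ?thesis .
  next
    case True
    have Rz: "r ^ h x \<le> R x y" "r ^ h y \<le> R x y" "\<rho> (z x) (z y) \<le> R x y"
      using nonneg[OF centre_in centre_in, OF X] r by (auto simp: R_def)
    have bd: "m \<le> h x \<and> m \<le> h y" if "R x y \<le> g * r ^ m" for m
    proof -
      have "g * r ^ m \<le> r ^ m" using g r by (intro mult_left_le_one_le) auto
      then have "r ^ h x \<le> r ^ m" "r ^ h y \<le> r ^ m" using Rz that by auto
      then show ?thesis using r power_strict_decreasing[of _ _ r] by (meson not_less)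
    qed
    \<comment> \<open>The maximum exists by \<open>bd\<close>. Maximality costs one factor
      \<open>r\<close>, and the horizontal edge between the ancestors at most one more: hence
      \<open>r\<^sup>2\<close> in the constant.\<close>
    define m where "m = (GREATEST m. R x y \<le> g * r ^ m)"
    have m: "R x y \<le> g * r ^ m" unfolding m_def
      by (rule GreatestI_nat[of _ 0 "h x"]) (use True bd in auto)
    have "\<not> R x y \<le> g * r ^ Suc m"
      using Greatest_le_nat[of "\<lambda>m. R x y \<le> g * r ^ m" "Suc m" "h x"] bd m_def by fastforce
    then have big: "g * r ^ Suc m < R x y" by simp
    have mh: "m \<le> h x" "m \<le> h y" using bd[OF m] by auto
    obtain u where u: "u \<in> X" "h u = m" "gdist E u x \<le> h x - m" "\<Phi> x \<subseteq> \<Phi> u"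
      using ancestor[OF X(1), of m "h x - m"] mh by auto
    obtain v where v: "v \<in> X" "h v = m" "gdist E v y \<le> h y - m" "\<Phi> y \<subseteq> \<Phi> v"
      using ancestor[OF X(2), of m "h y - m"] mh by auto
    have "g * r ^ m \<le> \<gamma> * r ^ m" using g r by (intro mult_right_mono) auto
    then have "\<rho> (z x) (z y) \<le> \<gamma> * r ^ h u" using Rz m u by simp
    \<comment> \<open>Cells grow towards the root, so \<open>z x\<close> and \<open>z y\<close>
      themselves lie in the cells of \<open>u\<close> and \<open>v\<close> and witness their
      proximity.\<close>
    then have "u = v \<or> (u, v) \<in> E"
      using near_adjacent[of u v "z x" "z y"] u v centre X by auto
    then have uv: "gdist E u v \<le> 1" using gdist_edge_le by auto
    have "gdist E x y \<le> gdist E x u + (gdist E u v + gdist E v y)"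
      using gdist_triangle[of x y u] gdist_triangle[of u y v] X u v by linarith
    then have "gdist E x y \<le> (h x - m) + (1 + (h y - m))"
      using uv u v gdist_commute[of x u] X by linarith
    then have "real (gdist E x y) \<le> real (h x) - real m + 1 + (real (h y) - real m)"
      using mh by linarith
    then have "real m - 1 \<le> gp x y" by (simp add: gromov_product_def)
    then have "r powr gp x y \<le> r powr (real m - 1)" using r by (intro powr_mono') auto
    also have "\<dots> = 1 / (g * r\<^sup>2) * (g * r ^ Suc m)"
      using r g by (simp add: powr_diff powr_realpow power2_eq_square)
    also have "\<dots> \<le> 1 / (g * r\<^sup>2) * R x y" using big r g by (intro mult_left_mono) auto
    finally show ?thesis .
  qed
  moreover have "0 < 1 / (g * r\<^sup>2)" using g r by simp
  ultimately show ?thesis using that by blast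
qed

lemma product_R_ex:
  "\<exists>M\<ge>1. \<forall>x\<in>X. \<forall>y\<in>X. R x y \<le> M * r powr gp x y \<and> r powr gp x y \<le> M * R x y"
proof -
  obtain B where B: "0 < B" "\<And>x y. x \<in> X \<Longrightarrow> y \<in> X \<Longrightarrow> R x y \<le> B * r powr gp x y"
    using R_le_product by blast
  obtain B' where B': "0 < B'" "\<And>x y. x \<in> X \<Longrightarrow> y \<in> X \<Longrightarrow> r powr gp x y \<le> B' * R x y"
    using product_le_R by blast
  define M where "M = max 1 (max B B')"
  have M: "1 \<le> M" "B \<le> M" "B' \<le> M" by (auto simp: M_def)
  have "R x y \<le> M * r powr gp x y \<and> r powr gp x y \<le> M * R x y" if X: "x \<in> X" "y \<in> X" for x y
  proof -
    have "B * r powr gp x y \<le> M * r powr gp x y" using M by (intro mult_right_mono) auto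
    moreover have "B' * R x y \<le> M * R x y" using M R_pos[OF X] by (intro mult_right_mono) auto
    ultimately show ?thesis using B(2)[OF X] B'(2)[OF X] by linarith
  qed
  with M show ?thesis by blast
qed

text \<open>Fixed once in the locale, so that hyperbolicity and the boundary estimates share one
  constant.\<close>

definition M :: real where
  "M = (SOME M. 1 \<le> M \<and> (\<forall>x\<in>X. \<forall>y\<in>X. R x y \<le> M * r powr gp x y \<and> r powr gp x y \<le> M * R x y))"

lemma M_ge_1: "1 \<le> M"
  and R_le: "x \<in> X \<Longrightarrow> y \<in> X \<Longrightarrow> R x y \<le> M * r powr gp x y"
  and product_le: "x \<in> X \<Longrightarrow> y \<in> X \<Longrightarrow> r powr gp x y \<le> M * R x y"
  using someI_ex[OF product_R_ex[unfolded Bex_def]] unfolding M_def by blast+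

lemma M0: "0 < M"
  using M_ge_1 by simp

lemma gromov_hyperbolic: "gromov_hyperbolic X E \<theta>"
proof -
  \<comment> \<open>One \<open>M\<close> for each passage between Gromov product and
    \<open>R\<close>, \<open>C\<close> from the triangle inequality of \<open>R\<close>, and 2 from
    bounding both summands by the larger one. Then \<delta> is chosen with
    \<open>r powr (- \<delta>) = D\<close>, and \<open>1 \<le> D\<close> gives its sign.\<close>
  define D where "D = 2 * C * M * M"
  have "1 * 1 \<le> C * M" using C_ge_1 M_ge_1 by (intro mult_mono) auto
  moreover have "1 * 1 \<le> (C * M) * M" using calculation M_ge_1 by (intro mult_mono) auto
  ultimately have D: "1 \<le> D" by (simp add: D_def)
  define \<delta> where "\<delta> = - (ln D / ln r)"
  have lr: "ln r < 0" using r by simp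
  have \<delta>0: "0 \<le> \<delta>" unfolding \<delta>_def using D lr by (simp add: divide_nonneg_neg)
  have rd: "r powr (- \<delta>) = D"
    unfolding \<delta>_def powr_def using r D lr by simp
  have "gp x y \<ge> min (gp x w) (gp w y) - \<delta>" if X: "x \<in> X" "y \<in> X" "w \<in> X" for x y w
  proof -
    define t where "t = min (gp x w) (gp w y)"
    have t: "r powr gp x w \<le> r powr t" "r powr gp w y \<le> r powr t"
      using r by (auto simp: t_def intro!: powr_mono')
    have Rt: "R x w \<le> M * r powr t" "R w y \<le> M * r powr t"
      using R_le[of x w] R_le[of w y] X t M0 by (meson mult_left_mono order_trans less_imp_le)+
    have "r powr gp x y \<le> M * R x y" using product_le X by simp
    also have "\<dots> \<le> M * (C * (R x w + R w y))" using R_triangle X M0 by (intro mult_left_mono) auto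
    also have "\<dots> \<le> M * (C * (M * r powr t + M * r powr t))"
      using M0 C0 Rt by (intro mult_left_mono add_mono) auto
    also have "\<dots> = r powr (t - \<delta>)" using rd r by (simp add: powr_diff powr_minus D_def field_simps)
    finally have "r powr gp x y \<le> r powr (t - \<delta>)" .
    then have "t - \<delta> \<le> gp x y" using r powr_less_mono'[of r "gp x y" "t - \<delta>"] by (meson not_less)
    then show ?thesis by (simp add: t_def)
  qed
  with \<delta>0 show ?thesis unfolding gromov_hyperbolic_def by blast
qed

end

section \<open>The hyperbolic boundary\<close>

context hyperbolic_model
begin

text \<open>\<open>R\<close> with the second vertex replaced by a point of \<open>K\<close>, that
  is, by a vertex of infinite height.\<close>

definition Q :: "'x \<Rightarrow> 'k \<Rightarrow> real" where
  "Q x p = r ^ h x + \<rho> (z x) p"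

text \<open>A single limit encodes that the heights tend to infinity and that the centres converge
  to \<open>p\<close>. The parameter \<open>a\<close> does not enter, so all visual distances turn
  out to have the same boundary points.\<close>

definition point_class :: "'k \<Rightarrow> (nat \<Rightarrow> 'x) set" where
  "point_class p = {s. range s \<subseteq> X \<and> (\<lambda>n. Q (s n) p) \<longlonglongrightarrow> 0}"

lemma Q_nonneg: "x \<in> X \<Longrightarrow> p \<in> K \<Longrightarrow> 0 \<le> Q x p"
  unfolding Q_def using nonneg[OF centre_in, of x p] r by simp

lemma R_le_Q:
  assumes "x \<in> X" "y \<in> X" "p \<in> K"
  shows "R x y \<le> C * (Q x p + Q y p)"
proof -
  have "r ^ h x \<le> C * r ^ h x" "r ^ h y \<le> C * r ^ h y"
    using r le_C_mult by auto
  moreover have "\<rho> (z x) (z y) \<le> C * (\<rho> (z x) p + \<rho> p (z y))"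
    using assms by (intro triangle centre_in)
  ultimately show ?thesis
    unfolding R_def Q_def using commute[OF centre_in[OF assms(2)] assms(3)]
    by (simp add: algebra_simps)
qed

lemma Q_le_R:
  assumes "x \<in> X" "y \<in> X" "p \<in> K"
  shows "Q y p \<le> C * (R x y + Q x p)"
proof -
  have "r ^ h y \<le> C * r ^ h y" "0 \<le> C * r ^ h x"
    using r C0 le_C_mult by auto
  moreover have "\<rho> (z y) p \<le> C * (\<rho> (z y) (z x) + \<rho> (z x) p)"
    using assms by (intro triangle centre_in)
  ultimately show ?thesis
    unfolding R_def Q_def using commute[OF centre_in[OF assms(2)] centre_in[OF assms(1)]]
    by (simp add: algebra_simps)
qed

section \<open>The visual distance in terms of \<open>R\<close>\<close>

lemma exponent_pos: "0 < a \<Longrightarrow> 0 < - a / ln r"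
  using r by (simp add: divide_pos_neg)

text \<open>Origin of the Hoelder exponent: this power turns the scale \<open>r powr g\<close> of
  \<open>R\<close> into the scale of the visual distance.\<close>

lemma exp_conv_powr: "exp (- a * g) = (r powr g) powr (- a / ln r)"
  using r by (simp add: powr_powr powr_def)

lemma visual_eq: "x \<noteq> y \<Longrightarrow> visual E \<theta> a x y = (r powr gp x y) powr (- a / ln r)"
  unfolding visual_def exp_conv_powr by simp

lemma visual_nonneg: "0 \<le> visual E \<theta> a x y"
  by (simp add: visual_def)

lemma visual_small:
  assumes "0 < a" "0 < \<epsilon>"
  obtains \<delta> where "0 < \<delta>" "\<And>x y. x \<in> X \<Longrightarrow> y \<in> X \<Longrightarrow> R x y < \<delta> \<Longrightarrow> visual E \<theta> a x y < \<epsilon>"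
proof
  let ?\<alpha> = "- a / ln r"
  note \<alpha> = exponent_pos[OF assms(1)]
  let ?\<delta> = "\<epsilon> powr (1 / ?\<alpha>) / M"
  show "0 < ?\<delta>" using assms M0 by simp
  fix x y assume X: "x \<in> X" "y \<in> X" and R: "R x y < ?\<delta>"
  show "visual E \<theta> a x y < \<epsilon>"
  proof (cases "x = y")
    case True
    then show ?thesis using assms by (simp add: visual_def)
  next
    case False
    have "r powr gp x y \<le> M * R x y" using product_le X by simp
    also have "\<dots> < \<epsilon> powr (1 / ?\<alpha>)" using R M0 by (simp add: field_simps)
    finally have "(r powr gp x y) powr ?\<alpha> < (\<epsilon> powr (1 / ?\<alpha>)) powr ?\<alpha>"
      using \<alpha> by (intro powr_less_mono2) auto
    also have "\<dots> = \<epsilon> powr (1 / ?\<alpha> * ?\<alpha>)" by (simp only: powr_powr)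
    also have "1 / ?\<alpha> * ?\<alpha> = 1" using \<alpha> by (intro nonzero_eq_divide_eq[THEN iffD1]) auto
    finally show ?thesis using False assms by (simp add: visual_eq)
  qed
qed

text \<open>The alternative \<open>x = y\<close> cannot be dropped: the visual distance vanishes on
  the diagonal, whereas \<open>R x x = 2 * r ^ h x\<close>. Eventually constant Cauchy sequences
  arise from it.\<close>

lemma R_small:
  assumes "0 < a" "0 < \<epsilon>"
  obtains \<delta> where "0 < \<delta>"
    "\<And>x y. x \<in> X \<Longrightarrow> y \<in> X \<Longrightarrow> visual E \<theta> a x y < \<delta> \<Longrightarrow> x = y \<or> R x y < \<epsilon>"
proof
  let ?\<alpha> = "- a / ln r"
  note \<alpha> = exponent_pos[OF assms(1)]
  let ?\<delta> = "(\<epsilon> / M) powr ?\<alpha>"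
  show "0 < ?\<delta>" using assms M0 by simp
  fix x y assume X: "x \<in> X" "y \<in> X" and v: "visual E \<theta> a x y < ?\<delta>"
  show "x = y \<or> R x y < \<epsilon>"
  proof (cases "x = y")
    case False
    have "(r powr gp x y) powr ?\<alpha> < (\<epsilon> / M) powr ?\<alpha>" using v False by (simp add: visual_eq)
    then have "r powr gp x y < \<epsilon> / M"
      using \<alpha> assms M0 by (meson divide_pos_pos less_imp_le not_less powr_mono2)
    then have "M * r powr gp x y < \<epsilon>" using M0 by (simp add: field_simps)
    then show ?thesis using R_le[OF X] by linarith
  qed simp
qed

text \<open>The two indices run independently, which serves both the Cauchy property
  (\<open>t = s\<close>) and, with \<open>m = n\<close>, the equivalence of two sequences.\<close>

lemma point_class_R:
  assumes "p \<in> K" "s \<in> point_class p" "t \<in> point_class p" "0 < \<epsilon>"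
  obtains N where "\<And>m n. N \<le> m \<Longrightarrow> N \<le> n \<Longrightarrow> R (s m) (t n) < \<epsilon>"
proof -
  have X: "s n \<in> X" "t n \<in> X" for n using assms by (auto simp: point_class_def)
  have e: "0 < \<epsilon> / (2 * C)" using assms C0 by simp
  have lim: "(\<lambda>n. Q (s n) p) \<longlonglongrightarrow> 0" "(\<lambda>n. Q (t n) p) \<longlonglongrightarrow> 0"
    using assms by (auto simp: point_class_def)
  obtain N N' where N: "\<And>n. n \<ge> N \<Longrightarrow> Q (s n) p < \<epsilon> / (2 * C)"
    "\<And>n. n \<ge> N' \<Longrightarrow> Q (t n) p < \<epsilon> / (2 * C)"
    using order_tendstoD(2)[OF lim(1) e] order_tendstoD(2)[OF lim(2) e]
    unfolding eventually_sequentially by blast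
  have "R (s m) (t n) < \<epsilon>" if "max N N' \<le> m" "max N N' \<le> n" for m n
  proof -
    have "R (s m) (t n) \<le> C * (Q (s m) p + Q (t n) p)" using R_le_Q X assms by simp
    also have "\<dots> < C * (\<epsilon> / (2 * C) + \<epsilon> / (2 * C))"
      using C0 N that by (intro mult_strict_left_mono add_strict_mono) auto
    also have "\<dots> = \<epsilon>" using C0 by (simp add: field_simps)
    finally show ?thesis .
  qed
  with that show ?thesis by blast
qed

lemma point_class_cauchy:
  assumes "0 < a" "p \<in> K" "s \<in> point_class p"
  shows "s \<in> cauchy_seqs X (visual E \<theta> a)"
proof -
  have X: "s n \<in> X" for n using assms by (auto simp: point_class_def)
  have "\<exists>N. \<forall>m\<ge>N. \<forall>n\<ge>N. visual E \<theta> a (s m) (s n) < \<epsilon>" if e: "0 < \<epsilon>" for \<epsilon>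
  proof -
    obtain \<delta> where d: "0 < \<delta>" "\<And>x y. x \<in> X \<Longrightarrow> y \<in> X \<Longrightarrow> R x y < \<delta> \<Longrightarrow> visual E \<theta> a x y < \<epsilon>"
      using visual_small[OF assms(1) e] by blast
    obtain N where "\<And>m n. N \<le> m \<Longrightarrow> N \<le> n \<Longrightarrow> R (s m) (s n) < \<delta>"
      using point_class_R[OF assms(2,3,3) d(1)] by blast
    then show ?thesis using d X by blast
  qed
  then show ?thesis unfolding cauchy_seqs_def using X by auto
qed

text \<open>Sequences at vanishing visual distance have, term by term, equal vertices or small
  \<open>R\<close>; in both cases \<open>Q\<close> of one controls \<open>Q\<close> of the other, so
  convergence to \<open>p\<close> spreads over the whole class.\<close>

lemma cauchy_equiv_point_class:
  assumes a: "0 < a" and p: "p \<in> K" and s: "s \<in> point_class p"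
  shows "cauchy_equiv X (visual E \<theta> a) `` {s} = point_class p"
proof (intro equalityI subsetI)
  have sX: "s n \<in> X" for n using s by (auto simp: point_class_def)
  fix t
  { assume t: "t \<in> point_class p"
    have tX: "t n \<in> X" for n using t by (auto simp: point_class_def)
    have "(\<lambda>n. visual E \<theta> a (s n) (t n)) \<longlonglongrightarrow> 0"
    proof (rule LIMSEQ_I)
      fix \<epsilon> :: real assume e: "0 < \<epsilon>"
      obtain \<delta> where d: "0 < \<delta>" "\<And>x y. x \<in> X \<Longrightarrow> y \<in> X \<Longrightarrow> R x y < \<delta> \<Longrightarrow> visual E \<theta> a x y < \<epsilon>"
        using visual_small[OF a e] by blast
      obtain N where "\<And>m n. N \<le> m \<Longrightarrow> N \<le> n \<Longrightarrow> R (s m) (t n) < \<delta>"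
        using point_class_R[OF p s t d(1)] by blast
      then show "\<exists>N. \<forall>n\<ge>N. norm (visual E \<theta> a (s n) (t n) - 0) < \<epsilon>"
        using d sX tX visual_nonneg by (metis abs_of_nonneg diff_zero real_norm_def)
    qed
    then show "t \<in> cauchy_equiv X (visual E \<theta> a) `` {s}"
      unfolding cauchy_equiv_def using point_class_cauchy[OF a p] s t by simp }
  { assume "t \<in> cauchy_equiv X (visual E \<theta> a) `` {s}"
    then have t: "t \<in> cauchy_seqs X (visual E \<theta> a)"
      and v: "(\<lambda>n. visual E \<theta> a (s n) (t n)) \<longlonglongrightarrow> 0"
      by (auto simp: cauchy_equiv_def)
    have tX: "t n \<in> X" for n using t by (auto simp: cauchy_seqs_def)
    have "(\<lambda>n. Q (t n) p) \<longlonglongrightarrow> 0"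
    proof (rule LIMSEQ_I)
      fix \<epsilon> :: real assume e: "0 < \<epsilon>"
      then have e': "0 < \<epsilon> / (2 * C)" using C0 by simp
      obtain \<delta> where d: "0 < \<delta>"
        "\<And>x y. x \<in> X \<Longrightarrow> y \<in> X \<Longrightarrow> visual E \<theta> a x y < \<delta> \<Longrightarrow> x = y \<or> R x y < \<epsilon> / (2 * C)"
        using R_small[OF a e'] by blast
      have Qs: "(\<lambda>n. Q (s n) p) \<longlonglongrightarrow> 0" using s by (simp add: point_class_def)
      have "\<forall>\<^sub>F n in sequentially. Q (s n) p < \<epsilon> / (2 * C) \<and> visual E \<theta> a (s n) (t n) < \<delta>"
        using order_tendstoD(2)[OF Qs e'] order_tendstoD(2)[OF v d(1)] by (rule eventually_conj)
      then obtain N where N: "\<And>n. n \<ge> N \<Longrightarrow> Q (s n) p < \<epsilon> / (2 * C)"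
        "\<And>n. n \<ge> N \<Longrightarrow> visual E \<theta> a (s n) (t n) < \<delta>"
        unfolding eventually_sequentially by blast
      have "norm (Q (t n) p - 0) < \<epsilon>" if n: "n \<ge> N" for n
      proof -
        have "s n = t n \<or> R (s n) (t n) < \<epsilon> / (2 * C)" using d(2) N(2)[OF n] sX tX by blast
        then have "Q (t n) p < \<epsilon>"
        proof
          assume "s n = t n"
          then have "Q (t n) p < \<epsilon> / (2 * C)" using N(1)[OF n] by simp
          also have "\<dots> \<le> C * (\<epsilon> / (2 * C))" using le_C_mult[OF less_imp_le[OF e']] .
          also have "\<dots> < \<epsilon>" using C0 e by simp
          finally show ?thesis .
        next
          assume R: "R (s n) (t n) < \<epsilon> / (2 * C)"
          have "Q (t n) p \<le> C * (R (s n) (t n) + Q (s n) p)" using Q_le_R sX tX p by simp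
          also have "\<dots> < C * (\<epsilon> / (2 * C) + \<epsilon> / (2 * C))"
            using C0 N(1)[OF n] R by (intro mult_strict_left_mono add_strict_mono) auto
          also have "\<dots> = \<epsilon>" using C0 by (simp add: field_simps)
          finally show ?thesis .
        qed
        then show ?thesis using Q_nonneg[OF tX p] by simp
      qed
      then show "\<exists>N. \<forall>n\<ge>N. norm (Q (t n) p - 0) < \<epsilon>" by blast
    qed
    then show "t \<in> point_class p" using tX by (auto simp: point_class_def) }
qed

lemma cauchy_seq_cases:
  assumes a: "0 < a" and s: "s \<in> cauchy_seqs X (visual E \<theta> a)"
  obtains (const) x where "x \<in> X" "\<forall>\<^sub>F n in sequentially. s n = x"
    | (limit) p where "p \<in> K" "s \<in> point_class p"
proof (cases "\<exists>x. \<forall>\<^sub>F n in sequentially. s n = x")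
  case True
  then obtain x where x: "\<forall>\<^sub>F n in sequentially. s n = x" by blast
  then obtain n where "s n = x" unfolding eventually_sequentially by blast
  moreover have "s n \<in> X" using s by (auto simp: cauchy_seqs_def)
  ultimately show ?thesis using x const by blast
next
  case False
  have X: "s n \<in> X" for n using s by (auto simp: cauchy_seqs_def)
  have key: "\<exists>N. (\<forall>n\<ge>N. r ^ h (s n) < \<epsilon>) \<and> (\<forall>m\<ge>N. \<forall>n\<ge>N. \<rho> (z (s m)) (z (s n)) < \<epsilon>)"
    if e: "0 < \<epsilon>" for \<epsilon>
  proof -
    obtain \<delta> where d: "0 < \<delta>"
      "\<And>x y. x \<in> X \<Longrightarrow> y \<in> X \<Longrightarrow> visual E \<theta> a x y < \<delta> \<Longrightarrow> x = y \<or> R x y < \<epsilon>"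
      using R_small[OF a e] by blast
    obtain N where N: "\<And>m n. N \<le> m \<Longrightarrow> N \<le> n \<Longrightarrow> visual E \<theta> a (s m) (s n) < \<delta>"
    proof -
      have "\<forall>\<epsilon>>0. \<exists>N. \<forall>m\<ge>N. \<forall>n\<ge>N. visual E \<theta> a (s m) (s n) < \<epsilon>"
        using s by (simp add: cauchy_seqs_def)
      with d(1) that show thesis by meson
    qed
    have dich: "s m = s n \<or> R (s m) (s n) < \<epsilon>" if "N \<le> m" "N \<le> n" for m n
      using d(2) N[OF that] X by blast
    have R_ge: "r ^ h (s m) \<le> R (s m) (s n)" "\<rho> (z (s m)) (z (s n)) \<le> R (s m) (s n)" for m n
      unfolding R_def using nonneg[OF centre_in[OF X] centre_in[OF X], of m n] r by auto
    have "r ^ h (s m) < \<epsilon>" if m: "N \<le> m" for m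
    proof -
      \<comment> \<open>As \<open>s\<close> is not eventually constant, every term differs from some
        later one; this excludes the first alternative in \<open>dich\<close>, and the second bounds
        the cell size at \<open>s m\<close>.\<close>
      obtain n where "N \<le> n" "s n \<noteq> s m"
        using False unfolding eventually_sequentially by metis
      then show ?thesis using dich[OF m, of n] R_ge[of m n] by auto
    qed
    moreover have "\<rho> (z (s m)) (z (s n)) < \<epsilon>" if "N \<le> m" "N \<le> n" for m n
      using dich[OF that] R_ge[of m n] zero_iff[OF centre_in[OF X] centre_in[OF X], of m n] e by auto
    ultimately show ?thesis by blast
  qed
  have "compactin (qtopology K \<rho>) K" using \<Phi>_compact[OF root] \<Phi>_root by simp
  then obtain p where p: "p \<in> K" "(\<lambda>n. \<rho> (z (s n)) p) \<longlonglongrightarrow> 0"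
    using compactin_Cauchy_limit[OF balls_open, of K "\<lambda>n. z (s n)"] centre_in[OF X] key by blast
  have "(\<lambda>n. r ^ h (s n)) \<longlonglongrightarrow> 0"
    using key r by (intro LIMSEQ_I) fastforce
  from tendsto_add[OF this p(2)] have "(\<lambda>n. Q (s n) p) \<longlonglongrightarrow> 0" by (simp add: Q_def)
  then show ?thesis using limit p X by (auto simp: point_class_def)
qed

section \<open>Geodesic rays and the evaluation of \<open>kappa_hat\<close>\<close>

lemma rayD:
  assumes "geodesic_ray E \<theta> s"
  shows "s n \<in> X" "h (s n) = n" "(s n, s (Suc n)) \<in> E" "\<Phi> (s (Suc n)) \<subseteq> \<Phi> (s n)"
proof -
  have s0: "s 0 = \<theta>" and g: "gdist E (s 0) (s (0 + k)) = k" for k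
    using assms unfolding geodesic_ray_def by blast+
  show e: "(s n, s (Suc n)) \<in> E" for n using assms unfolding geodesic_ray_def by blast
  then show "s n \<in> X" using edge_in by blast
  show hn: "h (s n) = n" for n using g[of n] s0 by simp
  show "\<Phi> (s (Suc n)) \<subseteq> \<Phi> (s n)" using \<Phi>_child[OF e] hn by simp
qed

text \<open>Each cell is the union of its children's cells, so \<open>p\<close> can be followed
  downwards forever. Heights grow by one per step, which makes the path geodesic between any two of
  its vertices.\<close>

lemma ray_to_point:
  assumes "p \<in> K"
  obtains s where "geodesic_ray E \<theta> s" "\<And>n. p \<in> \<Phi> (s n)"
proof -
  have "\<exists>s. \<forall>n. (s n \<in> X \<and> h (s n) = n \<and> p \<in> \<Phi> (s n)) \<and> (s n, s (Suc n)) \<in> E"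
  proof (rule dependent_nat_choice)
    show "\<exists>x. x \<in> X \<and> h x = 0 \<and> p \<in> \<Phi> x" using root \<Phi>_root assms by (intro exI[of _ \<theta>]) simp
  next
    fix x n assume "x \<in> X \<and> h x = n \<and> p \<in> \<Phi> x"
    then show "\<exists>y. (y \<in> X \<and> h y = Suc n \<and> p \<in> \<Phi> y) \<and> (x, y) \<in> E"
      using \<Phi>_children[of x] edge_in by blast
  qed
  then obtain s where s: "\<And>n. s n \<in> X" "\<And>n. h (s n) = n" "\<And>n. p \<in> \<Phi> (s n)"
    "\<And>n. (s n, s (Suc n)) \<in> E" by blast
  have "s 0 = \<theta>" using gdist_eq_0_iff[OF root s(1)] s(2)[of 0] by auto
  moreover have "gdist E (s m) (s (m + k)) = k" for m k
  proof (rule antisym)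
    have "(s m, s (m + k)) \<in> E ^^ k"
      unfolding relpow_fun_conv using s(4) by (intro exI[of _ "\<lambda>i. s (m + i)"]) auto
    then show "gdist E (s m) (s (m + k)) \<le> k" by (rule gdist_le_walk)
    show "k \<le> gdist E (s m) (s (m + k))"
      using gdist_triangle[OF root s(1) s(1), of "m + k" m] s(2) by simp
  qed
  ultimately have "geodesic_ray E \<theta> s" unfolding geodesic_ray_def using s(4) by blast
  with s that show ?thesis by blast
qed

lemma ray_in_point_class:
  assumes "geodesic_ray E \<theta> s" "\<And>n. p \<in> \<Phi> (s n)"
  shows "s \<in> point_class p"
proof -
  note s = rayD[OF assms(1)]
  have p: "p \<in> K" using assms(2)[of 0] \<Phi>_subset s(1) by blast
  have "(\<lambda>n. Q (s n) p) \<longlonglongrightarrow> 0"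
  proof (rule tendsto_sandwich[of "\<lambda>_. 0" _ _ "\<lambda>n. (1 + c) * r ^ n"])
    show "(\<lambda>n. (1 + c) * r ^ n) \<longlonglongrightarrow> 0" using r by (intro tendsto_mult_right_zero LIMSEQ_power_zero) auto
    show "\<forall>\<^sub>F n in sequentially. Q (s n) p \<le> (1 + c) * r ^ n"
      using \<Phi>_small[OF s(1) assms(2)] s(2)
      by (intro always_eventually) (auto simp: Q_def algebra_simps less_imp_le)
  qed (use Q_nonneg[OF s(1) p] in auto)
  then show ?thesis unfolding point_class_def using s(1) by auto
qed

text \<open>The ray is an arbitrary one in the class, not built around \<open>p\<close>. From index
  \<open>n\<close> on its centres lie in the compact cell \<open>\<Phi> (s n)\<close>, hence so does
  their limit \<open>p\<close>; and any common point of the cells is itself a limit of the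
  centres.\<close>

lemma ray_Inter:
  assumes ray: "geodesic_ray E \<theta> s" and p: "p \<in> K" and sp: "s \<in> point_class p"
  shows "(\<Inter>n. \<Phi> (s n)) = {p}"
proof -
  note s = rayD[OF ray]
  have Q0: "(\<lambda>n. Q (s n) p) \<longlonglongrightarrow> 0" using sp by (simp add: point_class_def)
  have lim: "(\<lambda>n. \<rho> (z (s n)) p) \<longlonglongrightarrow> 0"
  proof (rule tendsto_sandwich[OF _ _ tendsto_const Q0])
    show "\<forall>\<^sub>F n in sequentially. \<rho> (z (s n)) p \<le> Q (s n) p"
      using r by (intro always_eventually) (simp add: Q_def)
  qed (use nonneg[OF centre_in[OF s(1)] p] in auto)
  have mono: "\<Phi> (s (n + k)) \<subseteq> \<Phi> (s n)" for n k
    by (induction k) (use s(4) in auto)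
  have "p \<in> \<Phi> (s n)" for n
  proof -
    let ?f = "\<lambda>k. z (s (n + k))"
    have lim': "(\<lambda>k. \<rho> (?f k) p) \<longlonglongrightarrow> 0"
      using LIMSEQ_ignore_initial_segment[OF lim, of n] by (simp add: add.commute)
    have fin: "?f k \<in> \<Phi> (s n)" for k using centre[OF s(1)] mono by blast
    have "\<exists>N. \<forall>k\<ge>N. \<forall>l\<ge>N. \<rho> (?f k) (?f l) < e" if e: "0 < e" for e
    proof -
      obtain N where N: "\<And>m n. N \<le> m \<Longrightarrow> N \<le> n \<Longrightarrow> R (s m) (s n) < e"
        using point_class_R[OF p sp sp e] by blast
      have "\<rho> (?f k) (?f l) < e" if "N \<le> k" "N \<le> l" for k l
        using N[of "n + k" "n + l"] that r unfolding R_def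
        by (smt (verit) trans_le_add2 zero_le_power)
      then show ?thesis by blast
    qed
    then obtain q where q: "q \<in> \<Phi> (s n)" "(\<lambda>k. \<rho> (?f k) q) \<longlonglongrightarrow> 0"
      using compactin_Cauchy_limit[where f = ?f, OF balls_open \<Phi>_compact[OF s(1)] fin] by blast
    have "p = q"
      by (rule limit_unique[OF p _ _ lim' q(2)]) (use q(1) \<Phi>_subset s(1) centre_in in auto)
    with q show ?thesis by simp
  qed
  moreover have "q = p" if q: "\<And>n. q \<in> \<Phi> (s n)" for q
  proof -
    have qK: "q \<in> K" using q[of 0] \<Phi>_subset s(1) by blast
    have qc: "s \<in> point_class q" using ray_in_point_class[OF ray q] .
    have "(\<lambda>n. \<rho> (z (s n)) q) \<longlonglongrightarrow> 0"
    proof (rule tendsto_sandwich[OF _ _ tendsto_const])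
      show "(\<lambda>n. Q (s n) q) \<longlonglongrightarrow> 0" using qc by (simp add: point_class_def)
      show "\<forall>\<^sub>F n in sequentially. \<rho> (z (s n)) q \<le> Q (s n) q"
        using r by (intro always_eventually) (simp add: Q_def)
    qed (use nonneg[OF centre_in[OF s(1)] qK] in auto)
    then show ?thesis using limit_unique[OF qK p _ _ lim] centre_in[OF s(1)] by blast
  qed
  ultimately show ?thesis by blast
qed

lemma rays_nonempty:
  assumes "p \<in> K"
  shows "rays_to E \<theta> (point_class p) \<noteq> {}"
proof -
  obtain s where "geodesic_ray E \<theta> s" "\<And>n. p \<in> \<Phi> (s n)" using ray_to_point[OF assms] by blast
  then have "s \<in> rays_to E \<theta> (point_class p)" using ray_in_point_class by (simp add: rays_to_def)
  then show ?thesis by blast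
qed

lemma kappa_hat_point_class:
  assumes p: "p \<in> K"
  shows "kappa_hat E \<theta> \<Phi> (point_class p) = p"
proof -
  have "(\<Inter>n. \<Phi> (s n)) = {p}" if "s \<in> rays_to E \<theta> (point_class p)" for s
    using ray_Inter p that unfolding rays_to_def by blast
  \<comment> \<open>Without a ray in the class the condition under \<open>THE\<close> would hold
    vacuously for every point.\<close>
  moreover obtain s where "s \<in> rays_to E \<theta> (point_class p)"
    using rays_nonempty[OF p] by blast
  ultimately show ?thesis unfolding kappa_hat_def by (intro the_equality) auto
qed

lemma hyperbolic_boundary_eq:
  assumes a: "0 < a"
  shows "hyperbolic_boundary X E \<theta> a = point_class ` K"
proof (intro equalityI subsetI)
  let ?v = "visual E \<theta> a"
  fix \<xi> assume "\<xi> \<in> point_class ` K"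
  then obtain p where p: "p \<in> K" "\<xi> = point_class p" by blast
  obtain s where s: "s \<in> point_class p" using rays_nonempty[OF p(1)] unfolding rays_to_def by blast
  have "\<xi> \<in> completion X ?v"
    unfolding completion_def quotient_def
    using cauchy_equiv_point_class[OF a p(1) s] point_class_cauchy[OF a p(1) s] p(2) by blast
  \<comment> \<open>A constant sequence keeps its height, so \<open>Q x p\<close> is a positive
    constant and cannot tend to 0.\<close>
  moreover have "\<xi> \<noteq> completion_embed X ?v x" if x: "x \<in> X" for x
  proof
    assume "\<xi> = completion_embed X ?v x"
    moreover have "(\<lambda>n. x) \<in> completion_embed X ?v x"
      unfolding completion_embed_def cauchy_equiv_def cauchy_seqs_def
      using x by (auto simp: visual_def)
    ultimately have "(\<lambda>n::nat. Q x p) \<longlonglongrightarrow> 0" using p by (auto simp: point_class_def)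
    then have "Q x p = 0" by (simp add: LIMSEQ_const_iff)
    moreover have "0 < Q x p"
      unfolding Q_def using r nonneg[OF centre_in[OF x] p(1)] by (simp add: add_pos_nonneg)
    ultimately show False by simp
  qed
  ultimately show "\<xi> \<in> hyperbolic_boundary X E \<theta> a" unfolding hyperbolic_boundary_def by blast
next
  let ?v = "visual E \<theta> a"
  fix \<xi> assume \<xi>: "\<xi> \<in> hyperbolic_boundary X E \<theta> a"
  then obtain s where s: "s \<in> cauchy_seqs X ?v" "\<xi> = cauchy_equiv X ?v `` {s}"
    unfolding hyperbolic_boundary_def completion_def by (auto elim: quotientE)
  from a s(1) show "\<xi> \<in> point_class ` K"
  proof (cases rule: cauchy_seq_cases)
    case (const x)
    \<comment> \<open>Only tails matter for equivalence, so \<xi> is the class of the constant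
      sequence, which the boundary excludes.\<close>
    have "(\<lambda>n. ?v (s n) (t n)) \<longlonglongrightarrow> 0 \<longleftrightarrow> (\<lambda>n. ?v x (t n)) \<longlonglongrightarrow> 0" for t
      by (intro tendsto_cong eventually_mono[OF const(2)]) simp
    moreover have "(\<lambda>n. x) \<in> cauchy_seqs X ?v"
      using const(1) by (auto simp: cauchy_seqs_def visual_def)
    ultimately have "\<xi> = completion_embed X ?v x"
      unfolding s(2) completion_embed_def cauchy_equiv_def using s(1) by auto
    then show ?thesis using \<xi> const(1) unfolding hyperbolic_boundary_def by blast
  next
    case (limit p)
    then show ?thesis using cauchy_equiv_point_class[OF a] s(2) by blast
  qed
qed

section \<open>Gromov products along rays and the Hoelder bounds\<close>

lemma ray_product_mono:
  assumes "geodesic_ray E \<theta> s" "geodesic_ray E \<theta> t"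
  shows "incseq (\<lambda>n. gp (s n) (t n))"
proof (rule incseq_SucI)
  fix n
  note s = rayD[OF assms(1)] and t = rayD[OF assms(2)]
  have "gdist E (s (Suc n)) (t (Suc n)) \<le> gdist E (s n) (t n) + 2"
    using gdist_edge(1)[OF s(1) t(3), of "Suc n" n] gdist_edge(1)[OF t(1) s(3), of n n]
      gdist_commute[OF s(1) t(1)] by (smt (verit) add_2_eq_Suc' Suc_le_mono le_trans)
  then show "gp (s n) (t n) \<le> gp (s (Suc n)) (t (Suc n))"
    unfolding gromov_product_def using s(2) t(2) by simp
qed

lemma ray_R_bounds:
  assumes pq: "p \<in> K" "q \<in> K" "p \<noteq> q" and s: "s \<in> point_class p" and t: "t \<in> point_class q"
  shows "\<forall>\<^sub>F n in sequentially.
    \<rho> p q \<le> 2 * C\<^sup>2 * R (s n) (t n) \<and> R (s n) (t n) \<le> 2 * C\<^sup>2 * \<rho> p q"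
proof -
  have d: "0 < \<rho> p q" using nonneg[OF pq(1,2)] zero_iff[OF pq(1,2)] pq(3) by linarith
  have "(\<lambda>n. Q (s n) p + Q (t n) q) \<longlonglongrightarrow> 0 + 0"
    using s t by (intro tendsto_add) (auto simp: point_class_def)
  \<comment> \<open>Two triangle inequalities multiply the error by \<open>C\<^sup>2\<close>. Below
    this threshold that is less than half of \<open>\<rho> p q\<close> and is absorbed on the left
    of the first bound; the second only needs the error to be at most
    \<open>\<rho> p q\<close>.\<close>
  moreover have "0 < \<rho> p q / (2 * C\<^sup>2)" using d C0 by simp
  ultimately have "\<forall>\<^sub>F n in sequentially. Q (s n) p + Q (t n) q < \<rho> p q / (2 * C\<^sup>2)"
    by (intro order_tendstoD(2)) auto
  then show ?thesis
  proof (rule eventually_mono)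
    fix n assume small: "Q (s n) p + Q (t n) q < \<rho> p q / (2 * C\<^sup>2)"
    have X: "s n \<in> X" "t n \<in> X" using s t by (auto simp: point_class_def)
    note zK = centre_in[OF X(1)] centre_in[OF X(2)]
    have C2: "1 \<le> C\<^sup>2" "C \<le> C\<^sup>2" 
      using C_ge_1 le_C_mult[of C] C0 unfolding power2_eq_square by linarith+
    have le_C2: "t \<le> C\<^sup>2 * t" if "0 \<le> t" for t using mult_right_mono[OF C2(1) that] by simp
    define S where "S = Q (s n) p + Q (t n) q"
    have small: "2 * C\<^sup>2 * S < \<rho> p q" using small C0 by (simp add: S_def field_simps)
    have S: "S = r ^ h (s n) + r ^ h (t n) + \<rho> (z (s n)) p + \<rho> (z (t n)) q"
      by (simp add: S_def Q_def)
    note comm = commute[OF zK(1) pq(1)] commute[OF zK(2) pq(2)]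
    have pos: "0 \<le> \<rho> (z (s n)) p" "0 \<le> \<rho> (z (t n)) q" "0 \<le> r ^ h (s n)" "0 \<le> r ^ h (t n)"
      using nonneg zK pq r by auto
    have S0: "0 \<le> S" using pos by (simp add: S)
    have "\<rho> p q \<le> C * (\<rho> p (z (s n)) + \<rho> (z (s n)) q)" using triangle pq zK by simp
    also have "\<dots> \<le> C * (C * \<rho> p (z (s n)) + C * (\<rho> (z (s n)) (z (t n)) + \<rho> (z (t n)) q))"
      using C0 triangle[OF zK(1) pq(2) zK(2)] le_C_mult[of "\<rho> p (z (s n))"] pos comm
      by (intro mult_left_mono add_mono) auto
    also have "\<dots> = C\<^sup>2 * (\<rho> (z (s n)) p + \<rho> (z (t n)) q + \<rho> (z (s n)) (z (t n)))"
      by (simp add: power2_eq_square algebra_simps comm)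
    also have "\<dots> \<le> C\<^sup>2 * (S + R (s n) (t n))"
      using pos by (intro mult_left_mono) (auto simp: S R_def)
    finally have "\<rho> p q \<le> C\<^sup>2 * S + C\<^sup>2 * R (s n) (t n)" by (simp add: algebra_simps)
    then have 1: "\<rho> p q \<le> 2 * C\<^sup>2 * R (s n) (t n)" using small by linarith
    have "\<rho> (z (s n)) (z (t n)) \<le> C * (\<rho> (z (s n)) p + \<rho> p (z (t n)))"
      using triangle pq zK by simp
    also have "\<dots> \<le> C * (C * \<rho> (z (s n)) p + C * (\<rho> p q + \<rho> q (z (t n))))"
      using C0 triangle[OF pq(1) zK(2) pq(2)] le_C_mult[OF pos(1)]
      by (intro mult_left_mono add_mono) auto
    also have "\<dots> = C\<^sup>2 * (\<rho> (z (s n)) p + \<rho> (z (t n)) q) + C\<^sup>2 * \<rho> p q"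
      by (simp add: power2_eq_square algebra_simps comm)
    finally have "R (s n) (t n) \<le> C\<^sup>2 * S + C\<^sup>2 * \<rho> p q"
      using le_C2[OF pos(3)] le_C2[OF pos(4)] unfolding R_def S by (simp add: algebra_simps)
    moreover have "C\<^sup>2 * S \<le> C\<^sup>2 * \<rho> p q"
    proof -
      have "S \<le> C\<^sup>2 * S" using le_C2[OF S0] .
      then have "S \<le> \<rho> p q" using small S0 d by linarith
      then show ?thesis by (intro mult_left_mono) auto
    qed
    ultimately have "R (s n) (t n) \<le> 2 * C\<^sup>2 * \<rho> p q" by simp
    with 1 show "\<rho> p q \<le> 2 * C\<^sup>2 * R (s n) (t n) \<and> R (s n) (t n) \<le> 2 * C\<^sup>2 * \<rho> p q" by simp
  qed
qed

text \<open>The bounds do not mention the rays, so they survive the supremum in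
  \<open>boundary_product\<close>. As \<open>ln r < 0\<close>, an upper bound for \<open>R\<close>
  becomes a lower bound for the product.\<close>

lemma lim_ray_product_bounds:
  assumes pq: "p \<in> K" "q \<in> K" "p \<noteq> q"
    and s: "s \<in> rays_to E \<theta> (point_class p)" and t: "t \<in> rays_to E \<theta> (point_class q)"
  defines "L \<equiv> 2 * C\<^sup>2 * M"
  shows "lim (\<lambda>n. ereal (gp (s n) (t n)))
    \<in> {ereal (ln (L * \<rho> p q) / ln r) .. ereal (ln (\<rho> p q / L) / ln r)}"
proof -
  have d: "0 < \<rho> p q" using nonneg[OF pq(1,2)] zero_iff[OF pq(1,2)] pq(3) by linarith
  have L0: "0 < L" using C0 M0 by (simp add: L_def)
  have lr: "ln r < 0" using r by simp
  have st: "geodesic_ray E \<theta> s" "s \<in> point_class p" "geodesic_ray E \<theta> t" "t \<in> point_class q"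
    using s t by (auto simp: rays_to_def)
  have X: "s n \<in> X" "t n \<in> X" for n using rayD(1) st by auto
  have conv: "(\<lambda>n. ereal (gp (s n) (t n))) \<longlonglongrightarrow> lim (\<lambda>n. ereal (gp (s n) (t n)))"
  proof -
    \<comment> \<open>Advancing both rays by one step raises the heights by two in total and the
      distance by at most two. So the products increase, and \<open>lim\<close> is a genuine limit,
      a priori possibly infinite.\<close>
    have "incseq (\<lambda>n. ereal (gp (s n) (t n)))"
      using ray_product_mono[OF st(1,3)] by (simp add: incseq_def)
    then show ?thesis using LIMSEQ_SUP convergentI convergent_LIMSEQ_iff by blast
  qed
  have ev: "\<forall>\<^sub>F n in sequentially. ereal (ln (L * \<rho> p q) / ln r) \<le> ereal (gp (s n) (t n)) \<and>
     ereal (gp (s n) (t n)) \<le> ereal (ln (\<rho> p q / L) / ln r)"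
  proof (rule eventually_mono[OF ray_R_bounds[OF pq st(2,4)]])
    fix n let ?g = "gp (s n) (t n)"
    assume b: "\<rho> p q \<le> 2 * C\<^sup>2 * R (s n) (t n) \<and> R (s n) (t n) \<le> 2 * C\<^sup>2 * \<rho> p q"
    have "r powr ?g \<le> M * R (s n) (t n)" using product_le X by simp
    also have "\<dots> \<le> M * (2 * C\<^sup>2 * \<rho> p q)" using b M0 by (intro mult_left_mono) auto
    also have "\<dots> = L * \<rho> p q" by (simp add: L_def)
    finally have 1: "ln (r powr ?g) \<le> ln (L * \<rho> p q)" using r L0 d by (subst ln_le_cancel_iff) auto
    have "\<rho> p q \<le> 2 * C\<^sup>2 * R (s n) (t n)" using b by simp
    also have "\<dots> \<le> 2 * C\<^sup>2 * (M * r powr ?g)" using R_le X by (intro mult_left_mono) auto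
    finally have "\<rho> p q / L \<le> r powr ?g" using L0 by (simp add: L_def field_simps)
    then have 2: "ln (\<rho> p q / L) \<le> ln (r powr ?g)" using r L0 d by (subst ln_le_cancel_iff) auto
    show "ereal (ln (L * \<rho> p q) / ln r) \<le> ereal ?g \<and> ereal ?g \<le> ereal (ln (\<rho> p q / L) / ln r)"
      using 1 2 lr r by (simp add: ln_powr field_simps)
  qed
  have "ereal (ln (L * \<rho> p q) / ln r) \<le> lim (\<lambda>n. ereal (gp (s n) (t n)))"
    by (rule tendsto_lowerbound[OF conv]) (auto intro: eventually_mono[OF ev])
  moreover have "lim (\<lambda>n. ereal (gp (s n) (t n))) \<le> ereal (ln (\<rho> p q / L) / ln r)"
    by (rule tendsto_upperbound[OF conv]) (auto intro: eventually_mono[OF ev])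
  ultimately show ?thesis by simp
qed

lemma boundary_visual_bounds:
  assumes a: "0 < a"
  obtains D where "1 \<le> D"
    "\<And>p q. p \<in> K \<Longrightarrow> q \<in> K \<Longrightarrow>
      inverse D * \<rho> p q powr (- a / ln r) \<le> boundary_visual E \<theta> a (point_class p) (point_class q)"
    "\<And>p q. p \<in> K \<Longrightarrow> q \<in> K \<Longrightarrow>
      boundary_visual E \<theta> a (point_class p) (point_class q) \<le> D * \<rho> p q powr (- a / ln r)"
proof -
  define L where "L = 2 * C\<^sup>2 * M"
  define \<alpha> where "\<alpha> = - a / ln r"
  have \<alpha>: "0 < \<alpha>" using exponent_pos[OF a] by (simp add: \<alpha>_def)
  have "1 * 1 \<le> (2 * C\<^sup>2) * M"
    using M_ge_1 one_le_power[OF C_ge_1, of 2] by (intro mult_mono) auto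
  then have L: "1 \<le> L" by (simp add: L_def)
  have lr: "ln r < 0" using r by simp
  have "inverse (L powr \<alpha>) * \<rho> p q powr \<alpha> \<le> boundary_visual E \<theta> a (point_class p) (point_class q) \<and>
      boundary_visual E \<theta> a (point_class p) (point_class q) \<le> L powr \<alpha> * \<rho> p q powr \<alpha>"
    if pq: "p \<in> K" "q \<in> K" for p q
  proof (cases "p = q")
    \<comment> \<open>Here \<open>0 powr \<alpha> = 0\<close>, so all three quantities
      vanish.\<close>
    case True
    then show ?thesis using zero_iff[OF pq] by (simp add: boundary_visual_def)
  next
    case False
    have d: "0 < \<rho> p q" using nonneg[OF pq] zero_iff[OF pq] False by linarith
    let ?l = "ln (L * \<rho> p q) / ln r" and ?u = "ln (\<rho> p q / L) / ln r"
    let ?B = "boundary_product E \<theta> (point_class p) (point_class q)"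
    note lims = lim_ray_product_bounds[OF pq False, folded L_def]
    have "?B \<le> ereal ?u"
      unfolding boundary_product_def by (rule SUP_least) (use lims in auto)
    moreover have "ereal ?l \<le> ?B"
    proof -
      obtain s t where st: "s \<in> rays_to E \<theta> (point_class p)" "t \<in> rays_to E \<theta> (point_class q)"
        using rays_nonempty pq by blast
      have "ereal ?l \<le> lim (\<lambda>n. ereal (gp (s n) (t n)))" using lims[OF st] by simp
      also have "\<dots> \<le> ?B"
        unfolding boundary_product_def by (rule SUP_upper2[of "(s, t)"]) (use st in auto)
      finally show ?thesis .
    qed
    \<comment> \<open>The two finite bounds exclude the infinite values, which
      \<open>real_of_ereal\<close> would send to 0.\<close>
    ultimately obtain b where b: "?B = ereal b" "?l \<le> b" "b \<le> ?u"
      by (cases ?B) auto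
    have "point_class p \<noteq> point_class q"
      using kappa_hat_point_class pq False by metis
    then have bv: "boundary_visual E \<theta> a (point_class p) (point_class q) = exp (- a * b)"
      using b by (simp add: boundary_visual_def)
    have ex: "exp (- a * (ln x / ln r)) = x powr \<alpha>" if "0 < x" for x
      using that by (simp add: \<alpha>_def powr_def)
    have pos: "0 < L * \<rho> p q" "0 < \<rho> p q / L" using L d by auto
    have "exp (- a * b) \<le> exp (- a * ?l)" "exp (- a * ?u) \<le> exp (- a * b)"
      unfolding exp_le_cancel_iff
      using mult_left_mono[OF b(2), of a] mult_left_mono[OF b(3), of a] a
      by (simp_all only: mult_minus_left neg_le_iff_le less_imp_le)
    then have "exp (- a * b) \<le> (L * \<rho> p q) powr \<alpha>" "(\<rho> p q / L) powr \<alpha> \<le> exp (- a * b)"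
      using ex[OF pos(1)] ex[OF pos(2)] by (simp_all only:)
    then show ?thesis
      unfolding bv using L d by (simp add: powr_mult powr_divide field_simps)
  qed
  moreover have "1 \<le> L powr \<alpha>" using L \<alpha> by (simp add: ge_one_powr_ge_zero)
  ultimately show ?thesis using that[of "L powr \<alpha>"] unfolding \<alpha>_def by blast
qed

lemma boundary_Hoelder_equivalence:
  assumes a: "0 < a"
  shows "homeomorphic_map
      (qtopology (hyperbolic_boundary X E \<theta> a) (boundary_visual E \<theta> a))
      (qtopology K \<rho>) (kappa_hat E \<theta> \<Phi>) \<and>
    (\<exists>D\<ge>1. \<forall>\<xi>\<in>hyperbolic_boundary X E \<theta> a. \<forall>\<eta>\<in>hyperbolic_boundary X E \<theta> a.
      inverse D * \<rho> (kappa_hat E \<theta> \<Phi> \<xi>) (kappa_hat E \<theta> \<Phi> \<eta>) powr (- a / ln r)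
        \<le> boundary_visual E \<theta> a \<xi> \<eta> \<and>
      boundary_visual E \<theta> a \<xi> \<eta>
        \<le> D * \<rho> (kappa_hat E \<theta> \<Phi> \<xi>) (kappa_hat E \<theta> \<Phi> \<eta>) powr (- a / ln r))"
proof -
  let ?A = "hyperbolic_boundary X E \<theta> a" and ?k = "kappa_hat E \<theta> \<Phi>"
  note A = hyperbolic_boundary_eq[OF a]
  obtain D where D: "1 \<le> D"
    "\<And>p q. p \<in> K \<Longrightarrow> q \<in> K \<Longrightarrow>
      inverse D * \<rho> p q powr (- a / ln r) \<le> boundary_visual E \<theta> a (point_class p) (point_class q)"
    "\<And>p q. p \<in> K \<Longrightarrow> q \<in> K \<Longrightarrow>
      boundary_visual E \<theta> a (point_class p) (point_class q) \<le> D * \<rho> p q powr (- a / ln r)"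
    using boundary_visual_bounds[OF a] by blast
  have lower: "inverse D * \<rho> (?k \<xi>) (?k \<eta>) powr (- a / ln r) \<le> boundary_visual E \<theta> a \<xi> \<eta>"
    and upper: "boundary_visual E \<theta> a \<xi> \<eta> \<le> D * \<rho> (?k \<xi>) (?k \<eta>) powr (- a / ln r)"
    if "\<xi> \<in> ?A" "\<eta> \<in> ?A" for \<xi> \<eta>
    using that D kappa_hat_point_class unfolding A by auto
  have bij: "bij_betw ?k ?A K"
    unfolding A by (rule bij_betw_byWitness[where f' = point_class])
      (auto simp: kappa_hat_point_class)
  have "homeomorphic_map (qtopology ?A (boundary_visual E \<theta> a)) (qtopology K \<rho>) ?k"
    by (rule homeomorphic_map_qtopology_Hoelder[where f = ?k and \<alpha> = "- a / ln r" and D = D])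
      (use bij exponent_pos[OF a] D(1) nonneg lower upper in auto)
  then show ?thesis using D(1) lower upper by blast
qed

end

section \<open>From augmented trees to the model\<close>

lemma augmented_tree_hyperbolic_model:
  assumes K: "compact_homogeneous_space K \<rho> \<mu>"
    and T: "augmented_tree K \<rho> \<mu> X E\<^sub>v E \<theta> \<Phi> r\<^sub>0 \<gamma>"
  obtains C z c where "hyperbolic_model K \<rho> C X E \<theta> \<Phi> z r\<^sub>0 c \<gamma>"
proof -
  have "quasi_metric_on K \<rho>" and balls: "\<forall>\<xi>\<in>K. \<forall>r. openin (qtopology K \<rho>) (qball K \<rho> \<xi> r)"
    using K unfolding compact_homogeneous_space_def by simp_all
  then have qm: "\<forall>\<xi>\<in>K. \<forall>\<eta>\<in>K. 0 \<le> \<rho> \<xi> \<eta> \<and> (\<rho> \<xi> \<eta> = 0 \<longleftrightarrow> \<xi> = \<eta>) \<and> \<rho> \<xi> \<eta> = \<rho> \<eta> \<xi>"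
    and "\<exists>C\<ge>1. \<forall>\<xi>\<in>K. \<forall>\<eta>\<in>K. \<forall>\<zeta>\<in>K. \<rho> \<xi> \<eta> \<le> C * (\<rho> \<xi> \<zeta> + \<rho> \<zeta> \<eta>)"
    unfolding quasi_metric_on_def by blast+
  then obtain C where C: "1 \<le> C" "\<forall>\<xi>\<in>K. \<forall>\<eta>\<in>K. \<forall>\<zeta>\<in>K. \<rho> \<xi> \<eta> \<le> C * (\<rho> \<xi> \<zeta> + \<rho> \<zeta> \<eta>)"
    by blast
  interpret quasi_metric K \<rho> C
    by unfold_locales (use C qm in auto)
  have I: "index_tree K \<rho> \<mu> X E\<^sub>v \<theta> \<Phi> r\<^sub>0" and \<gamma>: "0 < \<gamma>"
    and E: "E = E\<^sub>v \<union> horizontal_edges \<rho> X E\<^sub>v \<theta> \<Phi> r\<^sub>0 \<gamma>"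
    using T unfolding augmented_tree_def by auto
  have tree: "rooted_tree X E\<^sub>v \<theta>"
    and \<Phi>: "\<And>x. x \<in> X \<Longrightarrow> \<Phi> x \<noteq> {}" "\<And>x. x \<in> X \<Longrightarrow> compactin (qtopology K \<rho>) (\<Phi> x)" "\<Phi> \<theta> = K"
    and children: "\<And>x. x \<in> X \<Longrightarrow> \<Phi> x = (\<Union>y\<in>descendants_at X E\<^sub>v \<theta> 1 x. \<Phi> y)"
    and r: "0 < r\<^sub>0" "r\<^sub>0 < 1"
    using I unfolding index_tree_def by auto
  have "\<exists>b>0. \<exists>c>0. \<forall>x\<in>X. \<exists>\<xi>\<in>K.
        qball K \<rho> \<xi> (b * r\<^sub>0 ^ gdist E\<^sub>v \<theta> x) \<subseteq> \<Phi> x \<and> \<Phi> x \<subseteq> qball K \<rho> \<xi> (c * r\<^sub>0 ^ gdist E\<^sub>v \<theta> x)"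
    using I unfolding index_tree_def by (elim conjE)
  then obtain b c where bc: "0 < b" "0 < c" "\<forall>x\<in>X. \<exists>\<xi>\<in>K.
        qball K \<rho> \<xi> (b * r\<^sub>0 ^ gdist E\<^sub>v \<theta> x) \<subseteq> \<Phi> x \<and> \<Phi> x \<subseteq> qball K \<rho> \<xi> (c * r\<^sub>0 ^ gdist E\<^sub>v \<theta> x)"
    by blast
  obtain z where z: "\<And>x. x \<in> X \<Longrightarrow> z x \<in> K"
    "\<And>x. x \<in> X \<Longrightarrow> qball K \<rho> (z x) (b * r\<^sub>0 ^ gdist E\<^sub>v \<theta> x) \<subseteq> \<Phi> x"
    "\<And>x. x \<in> X \<Longrightarrow> \<Phi> x \<subseteq> qball K \<rho> (z x) (c * r\<^sub>0 ^ gdist E\<^sub>v \<theta> x)"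
    using bc(3) by metis
  have \<theta>: "\<theta> \<in> X" and v: "E\<^sub>v \<subseteq> X \<times> X" "sym E\<^sub>v" "\<And>x y. x \<in> X \<Longrightarrow> y \<in> X \<Longrightarrow> (x, y) \<in> E\<^sub>v\<^sup>*"
    and tree_edge: "\<And>x y. (x, y) \<in> E\<^sub>v \<Longrightarrow>
      gdist E\<^sub>v \<theta> y = Suc (gdist E\<^sub>v \<theta> x) \<or> gdist E\<^sub>v \<theta> x = Suc (gdist E\<^sub>v \<theta> y)"
    using tree unfolding rooted_tree_def rooted_graph_def by auto
  interpret V: connected_graph X E\<^sub>v by unfold_locales (use v in auto)
  have \<Phi>K: "\<Phi> x \<subseteq> K" if "x \<in> X" for x using compactin_subset_topspace[OF \<Phi>(2)[OF that]] by simp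
  let ?H = "horizontal_edges \<rho> X E\<^sub>v \<theta> \<Phi> r\<^sub>0 \<gamma>"
  have horizontal: "(x, y) \<in> ?H \<longleftrightarrow> x \<in> X \<and> y \<in> X \<and> x \<noteq> y \<and> gdist E\<^sub>v \<theta> x = gdist E\<^sub>v \<theta> y \<and>
      set_dist \<rho> (\<Phi> x) (\<Phi> y) \<le> \<gamma> * r\<^sub>0 ^ gdist E\<^sub>v \<theta> x" for x y
  proof -
    \<comment> \<open>Horizontal edges start at level 1, but level 0 consists of the root alone, so
      this holds automatically for distinct vertices of equal height.\<close>
    have "gdist E\<^sub>v \<theta> x \<ge> 1" if "x \<in> X" "y \<in> X" "x \<noteq> y" "gdist E\<^sub>v \<theta> x = gdist E\<^sub>v \<theta> y"
      using that V.gdist_eq_0_iff[OF \<theta>, of x] V.gdist_eq_0_iff[OF \<theta>, of y] by fastforce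
    then show ?thesis unfolding horizontal_edges_def level_def by auto
  qed
  have set_dist_commute: "set_dist \<rho> (\<Phi> x) (\<Phi> y) = set_dist \<rho> (\<Phi> y) (\<Phi> x)" if "x \<in> X" "y \<in> X" for x y
  proof -
    have "{\<rho> \<xi> \<eta> |\<xi> \<eta>. \<xi> \<in> \<Phi> x \<and> \<eta> \<in> \<Phi> y} = {\<rho> \<xi> \<eta> |\<xi> \<eta>. \<xi> \<in> \<Phi> y \<and> \<eta> \<in> \<Phi> x}"
      using commute \<Phi>K[OF that(1)] \<Phi>K[OF that(2)] by blast
    then show ?thesis by (simp add: set_dist_def)
  qed
  interpret G: connected_graph X E
  proof
    show "E \<subseteq> X \<times> X" using v(1) horizontal E by auto
    show "sym E"
      using v(2) horizontal set_dist_commute unfolding E sym_def by (auto simp: eq_commute)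
    show "(x, y) \<in> E\<^sup>*" if "x \<in> X" "y \<in> X" for x y
      using v(3)[OF that] rtrancl_mono[of E\<^sub>v E] E by blast
  qed
  have height: "gdist E \<theta> x = gdist E\<^sub>v \<theta> x" if "x \<in> X" for x
  proof (rule G.gdist_eq_subgraph[OF V.connected_graph_axioms _ \<theta> _ that])
    show "gdist E\<^sub>v \<theta> y \<le> Suc (gdist E\<^sub>v \<theta> x)" if "(x, y) \<in> E" for x y
      using that E tree_edge[of x y] horizontal[of x y] by auto
  qed (simp add: E)
  have edge_in: "x \<in> X \<and> y \<in> X" if "(x, y) \<in> E" for x y using that G.edges_subset by blast
  have "hyperbolic_model K \<rho> C X E \<theta> \<Phi> z r\<^sub>0 c \<gamma>"
  proof unfold_locales
    show "\<theta> \<in> X" "\<Phi> \<theta> = K" "0 < r\<^sub>0" "r\<^sub>0 < 1" "0 < c" "0 < \<gamma>" by fact+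
    show "openin (qtopology K \<rho>) (qball K \<rho> p e)" if "p \<in> K" for p e using balls that by blast
    show "compactin (qtopology K \<rho>) (\<Phi> x)" if "x \<in> X" for x by (rule \<Phi>(2)[OF that])
    show "\<Phi> x = (\<Union>y\<in>{y. (x, y) \<in> E \<and> gdist E \<theta> y = Suc (gdist E \<theta> x)}. \<Phi> y)" if x: "x \<in> X" for x
    proof -
      \<comment> \<open>A horizontal edge joins equal heights, so an edge of \<open>E\<close> that
        raises the height comes from the tree.\<close>
      have "descendants_at X E\<^sub>v \<theta> 1 x = {y. (x, y) \<in> E \<and> gdist E \<theta> y = Suc (gdist E \<theta> x)}"
        unfolding V.descendants_at_1[OF \<theta> x]
        using edge_in height E horizontal x by (auto; metis n_not_Suc_n)
      with children[OF x] show ?thesis by simp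
    qed
    \<comment> \<open>The inner ball of the cell has positive radius and therefore contains its
      centre.\<close>
    show "z x \<in> \<Phi> x" if x: "x \<in> X" for x
      using z(2)[OF x] z(1)[OF x] zero_iff[OF z(1)[OF x] z(1)[OF x]] bc(1) r by (auto simp: qball_def)
    show "\<rho> (z x) p < c * r\<^sub>0 ^ gdist E \<theta> x" if "x \<in> X" "p \<in> \<Phi> x" for x p
      using z(3) that height by (auto simp: qball_def)
    show "\<exists>p\<in>\<Phi> x. \<exists>q\<in>\<Phi> y. \<rho> p q \<le> 2 * \<gamma> * r\<^sub>0 ^ gdist E \<theta> x"
      if xy: "(x, y) \<in> E" "gdist E \<theta> x = gdist E \<theta> y" for x y
    proof -
      have X: "x \<in> X" "y \<in> X" using edge_in xy by auto
      then have "(x, y) \<in> ?H" using xy height tree_edge[of x y] E by auto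
      then have "set_dist \<rho> (\<Phi> x) (\<Phi> y) \<le> \<gamma> * r\<^sub>0 ^ gdist E \<theta> x"
        unfolding height[OF X(1)] horizontal by (elim conjE)
      \<comment> \<open>The distance of the cells is an infimum; doubling makes the inequality
        strict, so that an actual pair of points satisfies it. This is the 2 in
        \<open>adjacent_near\<close>.\<close>
      also have "\<dots> < 2 * \<gamma> * r\<^sub>0 ^ gdist E \<theta> x" using \<gamma> r by simp
      finally have less: "Inf {\<rho> \<xi> \<eta> |\<xi> \<eta>. \<xi> \<in> \<Phi> x \<and> \<eta> \<in> \<Phi> y} < 2 * \<gamma> * r\<^sub>0 ^ gdist E \<theta> x"
        by (simp add: set_dist_def)
      have "{\<rho> \<xi> \<eta> |\<xi> \<eta>. \<xi> \<in> \<Phi> x \<and> \<eta> \<in> \<Phi> y} \<noteq> {}"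
        using \<Phi>(1)[OF X(1)] \<Phi>(1)[OF X(2)] by auto
      from cInf_lessD[OF this less]
      show ?thesis by (auto intro: less_imp_le)
    qed
    show "x = y \<or> (x, y) \<in> E"
      if X: "x \<in> X" "y \<in> X" and xy: "gdist E \<theta> x = gdist E \<theta> y" and pq: "p \<in> \<Phi> x" "q \<in> \<Phi> y"
        and le: "\<rho> p q \<le> \<gamma> * r\<^sub>0 ^ gdist E \<theta> x" for x y p q
    proof -
      have "set_dist \<rho> (\<Phi> x) (\<Phi> y) \<le> \<rho> p q"
        unfolding set_dist_def
      proof (rule cInf_lower)
        show "bdd_below {\<rho> \<xi> \<eta> |\<xi> \<eta>. \<xi> \<in> \<Phi> x \<and> \<eta> \<in> \<Phi> y}"
          by (rule bdd_belowI[of _ 0]) (use nonneg \<Phi>K X in blast)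
      qed (use pq in blast)
      then show ?thesis using le X xy height E horizontal by auto
    qed
  qed
  with that show ?thesis by blast
qed

theorem theorem3p6:
  fixes K :: "'k set" and \<rho> :: "'k \<Rightarrow> 'k \<Rightarrow> real" and \<mu> :: "'k measure"
    and X :: "'x set" and E\<^sub>v E :: "'x rel" and \<theta> :: 'x and \<Phi> :: "'x \<Rightarrow> 'k set"
    and r\<^sub>0 \<gamma> :: real
  assumes "compact_homogeneous_space K \<rho> \<mu>"
    and "augmented_tree K \<rho> \<mu> X E\<^sub>v E \<theta> \<Phi> r\<^sub>0 \<gamma>"
  shows "gromov_hyperbolic X E \<theta> \<and>
    (\<forall>a>0.
       homeomorphic_map
         (qtopology (hyperbolic_boundary X E \<theta> a) (boundary_visual E \<theta> a))
         (qtopology K \<rho>) (kappa_hat E \<theta> \<Phi>) \<and>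
       (\<exists>C\<ge>1. \<forall>\<xi>\<in>hyperbolic_boundary X E \<theta> a. \<forall>\<eta>\<in>hyperbolic_boundary X E \<theta> a.
          inverse C * \<rho> (kappa_hat E \<theta> \<Phi> \<xi>) (kappa_hat E \<theta> \<Phi> \<eta>) powr (- a / ln r\<^sub>0)
            \<le> boundary_visual E \<theta> a \<xi> \<eta> \<and>
          boundary_visual E \<theta> a \<xi> \<eta>
            \<le> C * \<rho> (kappa_hat E \<theta> \<Phi> \<xi>) (kappa_hat E \<theta> \<Phi> \<eta>) powr (- a / ln r\<^sub>0)))"
proof -
  obtain C z c where "hyperbolic_model K \<rho> C X E \<theta> \<Phi> z r\<^sub>0 c \<gamma>"
    using augmented_tree_hyperbolic_model[OF assms] by blast
  then interpret hyperbolic_model K \<rho> C X E \<theta> \<Phi> z r\<^sub>0 c \<gamma> .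
  show ?thesis using gromov_hyperbolic boundary_Hoelder_equivalence by blast
qed

end
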